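(* Let $p$ be a prime. Write $M_n$ for the Motzkin numbers and $T_n$ for the central trinomial coefficients. The asymptotic density of $0$ in $(M_n\bmod p)_{n\ge0}$ is $1$ if $p\mid T_n$ for some $0\le n<p$. Otherwise, if $p>2$, it is $$\begin{aligned}D_0=\ &\frac{\left|\{0\le n<p-2 : M_n\equiv0\}\right|}{p}+\frac{2\left|\{0\le m<p-1 : T_m\equiv T_{p-1}T_{m+1}\}\right|}{(p-1)(p+1)}\\&+\frac{2\left|\{0\le m<p-1 : T_m\equiv T_{m+1}\}\right|}{(p-1)p(p+1)},\end{aligned}$$ where $n,m$ range over integers and all congruences are modulo $p$. Additionally, still in this second case ($p>2$ and $p\nmid T_n$ for all $0\le n<p$): if it is true that for every prime $r$ dividing none of $T_0,\dots,T_{r-1}$ the residues mod $r$ of $T_0,\dots,T_{r-1}$ generate $\mathbb{F}_r^\times$ as a multiplicative group, then every nonzero element of $\mathbb{F}_p$ has asymptotic density $\frac{1-D_0}{p-1}$ in $(M_n\bmod p)_{n\ge0}$. Lastly, for every prime $p>2$, the asymptotic density $D_0$ of $0$ in $(M_n\bmod p)_{n\ge 0}$ satisfies $D_0\geq\frac{2}{p(p-1)}$.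
   Context: For a Laurent polynomial $Q(x)$, $\mathrm{ct}[Q(x)]$ denotes its constant term. For $n\ge0$: $T_n=\mathrm{ct}\left[(x^{-1}+1+x)^n\right]$ (central trinomial coefficients) and $M_n=\mathrm{ct}\left[(x^{-1}+1+x)^n(1-x^2)\right]$ (Motzkin numbers). The asymptotic density of a set $S\subseteq\mathbb{N}=\{0,1,2,\dots\}$ is $\lim_{N\to\infty}\frac{|S\cap\{n\in\mathbb{N}: n<N\}|}{N}$; the density of a value $x\in\mathbb{F}_p$ in a sequence $(c_n)$ over $\mathbb{F}_p$ is the asymptotic density of $\{n\in\mathbb{N}: c_n=x\}$. Saying that a density equals a number includes the assertion that the limit exists. *)

theory Defs
  imports
    "HOL-Number_Theory.Residues"
    "HOL-Algebra.Generated_Groups"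
    "HOL-Computational_Algebra.Formal_Laurent_Series"
begin

(* Integer Laurent polynomials are elements of the ring of formal Laurent series;
   the constant term is the coefficient of index 0. *)

definition trinomial_lpoly :: "int fls" where
  "trinomial_lpoly = fls_X_inv + 1 + fls_X"

definition central_trinomial :: "nat \<Rightarrow> int" where
  "central_trinomial n = fls_nth (trinomial_lpoly ^ n) 0"

definition motzkin :: "nat \<Rightarrow> int" where
  "motzkin n = fls_nth (trinomial_lpoly ^ n * (1 - fls_X ^ 2)) 0"

definition has_asymp_density :: "nat set \<Rightarrow> real \<Rightarrow> bool" where
  "has_asymp_density S d \<longleftrightarrow>
     (\<lambda>N. real (card (S \<inter> {n. n < N})) / real N) \<longlonglongrightarrow> d"

(* Elements of F_p are represented by their residues in {0..p-1}. *)
definition value_density_mod :: "nat \<Rightarrow> (nat \<Rightarrow> int) \<Rightarrow> int \<Rightarrow> real \<Rightarrow> bool" where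
  "value_density_mod p c x d \<longleftrightarrow> has_asymp_density {n. c n mod int p = x} d"

definition residues_generate_units :: "nat \<Rightarrow> bool" where
  "residues_generate_units r \<longleftrightarrow>
     generate (units_of (residue_ring (int r)))
       ((\<lambda>n. central_trinomial n mod int r) ` {n. n < r})
     = carrier (units_of (residue_ring (int r)))"

definition motzkin_zero_density :: "nat \<Rightarrow> real" where
  "motzkin_zero_density p =
     real (card {n. n < p - 2 \<and> [motzkin n = 0] (mod int p)}) / real p
   + 2 * real (card {m. m < p - 1 \<and>
         [central_trinomial m = central_trinomial (p - 1) * central_trinomial (m + 1)] (mod int p)})
       / ((real p - 1) * (real p + 1))
   + 2 * real (card {m. m < p - 1 \<and>
         [central_trinomial m = central_trinomial (m + 1)] (mod int p)})
       / ((real p - 1) * real p * (real p + 1))"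

end

theory Submission
  imports Defs
begin

text \<open>Everything is reduced to the central trinomial coefficients \<open>T\<^sub>n\<close>. They satisfy the Lucas
  congruence \<open>T\<^bsub>mp+k\<^esub> = T\<^sub>m T\<^sub>k\<close> for \<open>k < p\<close>, and \<open>2 M\<^sub>n = 3 T\<^sub>n + 2 T\<^bsub>n+1\<^esub> - T\<^bsub>n+2\<^esub>\<close>, so on each
  residue class mod \<open>p\<close> the value \<open>2 M\<^bsub>mp+k\<^esub>\<close> is a fixed linear form \<open>a T\<^sub>m + b T\<^bsub>m+1\<^esub>\<close>.
  If some \<open>T\<^sub>j\<close> with \<open>j < p\<close> vanishes, then so does \<open>T\<^sub>n\<close> unless \<open>n\<close> avoids the digit \<open>j\<close>.
  When no \<open>T\<^sub>n\<close> vanishes, \<open>T\<^bsub>p-1\<^esub>\<close> squares to 1, and hence the set where such a form takes a given value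
  is self-similar: its section along \<open>n = p\<^sup>2 - 1 (mod p\<^sup>2)\<close> is the set itself, while along the
  other classes mod \<open>p\<^sup>2\<close> the form is a constant times \<open>T\<^sub>m\<close>. This determines its density.
  The reflection \<open>(-3)\<^sup>k T\<^bsub>p-1-k\<^esub> = T\<^bsub>p-1\<^esub> T\<^sub>k\<close> makes the last two residue classes contribute equally.\<close>

section \<open>Central trinomial coefficients and Motzkin numbers modulo a prime\<close>

definition trinomial_coeff :: "nat \<Rightarrow> int \<Rightarrow> int" where
  "trinomial_coeff n k = fls_nth (trinomial_lpoly ^ n) k"

lemma trinomial_coeff_0: "trinomial_coeff 0 k = (if k = 0 then 1 else 0)"
  by (simp add: trinomial_coeff_def)

lemma trinomial_coeff_Suc:
  "trinomial_coeff (Suc n) k =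
     trinomial_coeff n (k + 1) + trinomial_coeff n k + trinomial_coeff n (k - 1)"
  by (simp add: trinomial_coeff_def trinomial_lpoly_def distrib_right
      fls_X_times_conv_shift fls_X_inv_times_conv_shift)

lemma central_trinomial_eq: "central_trinomial n = trinomial_coeff n 0"
  by (simp add: trinomial_coeff_def central_trinomial_def)

lemma trinomial_coeff_minus: "trinomial_coeff n (- k) = trinomial_coeff n k"
proof (induction n arbitrary: k)
  case (Suc n)
  show ?case
    using Suc[of "k - 1"] Suc[of k] Suc[of "k + 1"]
    by (simp add: trinomial_coeff_Suc)
qed (simp add: trinomial_coeff_0)

lemma trinomial_coeff_eq_0: "int n < \<bar>k\<bar> \<Longrightarrow> trinomial_coeff n k = 0"
proof (induction n arbitrary: k)
  case (Suc n)
  then have "int n < \<bar>k - 1\<bar>" "int n < \<bar>k\<bar>" "int n < \<bar>k + 1\<bar>"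
    by linarith+
  then show ?case
    using Suc.IH by (simp add: trinomial_coeff_Suc)
qed (simp add: trinomial_coeff_0)

text \<open>Coefficientwise form of \<open>x d(P\<^sup>n)/dx = n P\<^sup>n\<^sup>-\<^sup>1 (x - x\<^sup>-\<^sup>1)\<close>.\<close>
lemma trinomial_coeff_derivative:
  "k * trinomial_coeff (Suc n) k =
     int (Suc n) * (trinomial_coeff n (k - 1) - trinomial_coeff n (k + 1))"
proof (induction n arbitrary: k)
  case 0
  show ?case
    by (auto simp: trinomial_coeff_0 trinomial_coeff_Suc)
next
  case (Suc n)
  have "k * trinomial_coeff (Suc (Suc n)) k =
      (k + 1) * trinomial_coeff (Suc n) (k + 1) + k * trinomial_coeff (Suc n) k
      + (k - 1) * trinomial_coeff (Suc n) (k - 1)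
      + (trinomial_coeff (Suc n) (k - 1) - trinomial_coeff (Suc n) (k + 1))"
    by (simp add: trinomial_coeff_Suc[of "Suc n"] algebra_simps)
  also have "\<dots> = int (Suc n) * (trinomial_coeff (Suc n) (k - 1) - trinomial_coeff (Suc n) (k + 1))
      + (trinomial_coeff (Suc n) (k - 1) - trinomial_coeff (Suc n) (k + 1))"
    unfolding Suc.IH by (simp add: trinomial_coeff_Suc[of n] algebra_simps)
  finally show ?case
    by (simp add: algebra_simps)
qed

lemma central_trinomial_Suc:
  "central_trinomial (Suc n) = central_trinomial n + 2 * trinomial_coeff n 1"
  using trinomial_coeff_minus[of n 1]
  by (simp add: central_trinomial_eq trinomial_coeff_Suc)

lemma central_trinomial_Suc_Suc:
  "central_trinomial (Suc (Suc n)) =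
     2 * central_trinomial (Suc n) + central_trinomial n + 2 * trinomial_coeff n 2"
  using trinomial_coeff_minus[of n 1] trinomial_coeff_minus[of n 2]
  by (simp add: central_trinomial_eq trinomial_coeff_Suc)

text \<open>The derivative identity at k = 1 expresses the coefficient at index 1 through T_n and
  the coefficient at index 2; the one-step and two-step recursions then eliminate both off-centre
  coefficients.\<close>

lemma central_trinomial_recurrence:
  "int (n + 2) * central_trinomial (n + 2) =
     int (2 * n + 3) * central_trinomial (n + 1) + 3 * int (n + 1) * central_trinomial n"
proof -
  have 1: "trinomial_coeff (Suc n) 1 = int (Suc n) * (central_trinomial n - trinomial_coeff n 2)"
    using trinomial_coeff_derivative[of 1 n] by (simp add: central_trinomial_eq)
  have 2: "central_trinomial (Suc (Suc n)) - central_trinomial (Suc n)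
      = 2 * (int (Suc n) * (central_trinomial n - trinomial_coeff n 2))"
    unfolding 1[symmetric] using central_trinomial_Suc[of "Suc n"] by simp
  show ?thesis
    using 2 central_trinomial_Suc_Suc[of n] by (simp add: algebra_simps) algebra
qed

lemma motzkin_eq: "motzkin n = central_trinomial n - trinomial_coeff n 2"
proof -
  have "motzkin n = trinomial_coeff n 0 - trinomial_coeff n (- 2)"
    by (simp add: motzkin_def trinomial_coeff_def right_diff_distrib fls_X_power_times_conv_shift)
  then show ?thesis
    by (simp add: central_trinomial_eq trinomial_coeff_minus)
qed

text \<open>Eliminating the index-2 coefficient leaves only central trinomial coefficients, so
  Motzkin numbers inherit the Lucas congruence. Doubling avoids a division and is invertible modulo
  odd p.\<close>

lemma two_motzkin:
  "2 * motzkin n = 3 * central_trinomial n + 2 * central_trinomial (n + 1) - central_trinomial (n + 2)"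
  using central_trinomial_Suc_Suc[of n] by (simp add: motzkin_eq)

lemma central_trinomial_0 [simp]: "central_trinomial 0 = 1"
  by (simp add: central_trinomial_eq trinomial_coeff_0)

lemma central_trinomial_1 [simp]: "central_trinomial (Suc 0) = 1"
  by (simp add: central_trinomial_eq trinomial_coeff_0 trinomial_coeff_Suc)

lemma central_trinomial_2: "central_trinomial 2 = 3"
  using central_trinomial_recurrence[of 0] by (simp add: numeral_2_eq_2)


section \<open>Lucas congruences modulo p\<close>

text \<open>Freshman's dream, phrased as divisibility because it is applied in integer Laurent
  series, a ring of characteristic 0.\<close>

lemma prime_dvd_power_add_diff:
  fixes a b :: "'a::comm_ring_1"
  assumes "prime p"
  shows "of_nat p dvd (a + b) ^ p - (a ^ p + b ^ p)"
proof -
  have p: "p \<ge> 2" using assms by (rule prime_ge_2_nat)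
  have split: "{..p} = insert 0 (insert p {1..<p})"
    using p by auto
  have "(a + b) ^ p - (a ^ p + b ^ p) = (\<Sum>k\<in>{1..<p}. of_nat (p choose k) * a ^ k * b ^ (p - k))"
    unfolding binomial_ring split using p by simp
  also have "of_nat p dvd \<dots>"
  proof (rule dvd_sum)
    fix k assume "k \<in> {1..<p}"
    then have "p dvd (p choose k)"
      using assms by (intro dvd_choose_prime) auto
    then have "(of_nat p :: 'a) dvd of_nat (p choose k)"
      by (metis dvd_def of_nat_mult)
    then show "(of_nat p :: 'a) dvd of_nat (p choose k) * a ^ k * b ^ (p - k)"
      by (simp add: mult.assoc)
  qed
  finally show ?thesis .
qed

lemma fls_nth_cong_of_dvd:
  fixes f g :: "int fls"
  assumes "of_nat p dvd f - g"
  shows "[fls_nth f k = fls_nth g k] (mod int p)"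
proof -
  obtain h where "f - g = of_nat p * h"
    using assms by (rule dvdE)
  then have "fls_nth (f - g) k = int p * fls_nth h k"
    by simp
  then show ?thesis
    by (simp add: cong_iff_dvd_diff)
qed

lemma power_diff_dvd:
  fixes a b :: "'a::comm_ring_1"
  shows "a - b dvd a ^ n - b ^ n"
proof (induction n)
  case (Suc n)
  have "a ^ Suc n - b ^ Suc n = a * (a ^ n - b ^ n) + (a - b) * b ^ n"
    by (simp add: algebra_simps)
  then show ?case
    using Suc by simp
qed simp

text \<open>Modulo p, the power P^(mp+k) of the trinomial P is Q^m P^k with Q = x^-p + 1 + x^p.
  Exponents in Q^m are multiples of p and those in P^k lie strictly between -p and p, so only the
  constant term of P^k reaches index pi. A general i is carried for the induction on m.\<close>

lemma trinomial_coeff_lucas: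
  assumes p: "prime p" and k: "k < p"
  shows "[trinomial_coeff (m * p + k) (int p * i) =
          trinomial_coeff m i * central_trinomial k] (mod int p)"
proof -
  define Q :: "int fls" where "Q = fls_X_inv ^ p + 1 + fls_X ^ p"
  \<comment> \<open>With three summands, Freshman's dream is applied twice.\<close>
  have "of_nat p dvd (trinomial_lpoly ^ p - ((fls_X_inv + 1) ^ p + fls_X ^ p))
      + ((fls_X_inv + 1) ^ p - (fls_X_inv ^ p + (1 :: int fls) ^ p))"
    unfolding trinomial_lpoly_def by (intro dvd_add prime_dvd_power_add_diff p)
  then have "of_nat p dvd trinomial_lpoly ^ p - Q"
    by (simp add: Q_def algebra_simps)
  also have "trinomial_lpoly ^ p - Q dvd (trinomial_lpoly ^ p) ^ m - Q ^ m"
    by (rule power_diff_dvd)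
  also have "(trinomial_lpoly ^ p) ^ m - Q ^ m dvd
      ((trinomial_lpoly ^ p) ^ m - Q ^ m) * trinomial_lpoly ^ k"
    by simp
  also have "\<dots> = trinomial_lpoly ^ (m * p + k) - Q ^ m * trinomial_lpoly ^ k"
    by (simp add: power_add power_mult left_diff_distrib mult.commute[of m])
  finally have "[trinomial_coeff (m * p + k) (int p * i) =
      fls_nth (Q ^ m * trinomial_lpoly ^ k) (int p * i)] (mod int p)"
    unfolding trinomial_coeff_def by (rule fls_nth_cong_of_dvd)
  also have "fls_nth (Q ^ m * trinomial_lpoly ^ k) (int p * i) =
      trinomial_coeff m i * central_trinomial k"
  \<comment> \<open>Multiplying by Q shifts indices by p, which is the recursion of
    \<open>trinomial_coeff\<close> in m at scale p.\<close>
  proof (induction m arbitrary: i)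
    case 0
    have "trinomial_coeff k (int p * i) = 0" if "i \<noteq> 0"
    proof (rule trinomial_coeff_eq_0)
      have "int p * 1 \<le> int p * \<bar>i\<bar>"
        using that by (intro mult_left_mono) auto
      with k have "int k < int p * \<bar>i\<bar>"
        by linarith
      then show "int k < \<bar>int p * i\<bar>"
        by (simp add: abs_mult)
    qed
    then show ?case
      by (auto simp: trinomial_coeff_0 trinomial_coeff_def central_trinomial_def)
  next
    case (Suc m)
    define F where "F = Q ^ m * trinomial_lpoly ^ k"
    have "Q ^ Suc m * trinomial_lpoly ^ k = Q * F"
      by (simp add: F_def mult.assoc)
    also have "fls_nth (Q * F) (int p * i) =
        fls_nth F (int p * (i + 1)) + fls_nth F (int p * i) + fls_nth F (int p * (i - 1))"
      by (simp add: Q_def distrib_right fls_X_power_times_conv_shift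
          fls_X_inv_power_times_conv_shift algebra_simps)
    also have "\<dots> = trinomial_coeff (Suc m) i * central_trinomial k"
      unfolding F_def Suc.IH by (simp add: trinomial_coeff_Suc algebra_simps)
    finally show ?case .
  qed
  finally show ?thesis .
qed

lemma central_trinomial_lucas:
  assumes "prime p" "k < p"
  shows "[central_trinomial (m * p + k) = central_trinomial m * central_trinomial k] (mod int p)"
  using trinomial_coeff_lucas[OF assms, of m 0] by (simp add: central_trinomial_eq)

text \<open>Peeling off the lowest base-p digit of k and reattaching it reduces l by one. This
  version allows a whole block of l digits to be appended to m.\<close>

lemma central_trinomial_lucas_power:
  assumes p: "prime p" and "k < p ^ l"
  shows "[central_trinomial (m * p ^ l + k) = central_trinomial m * central_trinomial k] (mod int p)"
  using assms(2)
proof (induction l arbitrary: k)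
  case (Suc l)
  define a where "a = k div p"
  define b where "b = k mod p"
  have k: "k = a * p + b" by (simp add: a_def b_def)
  have b: "b < p" using prime_gt_0_nat[OF p] by (simp add: b_def)
  have a: "a < p ^ l"
    using Suc.prems by (simp add: a_def less_mult_imp_div_less mult.commute)
  have "[central_trinomial ((m * p ^ l + a) * p + b) =
      central_trinomial (m * p ^ l + a) * central_trinomial b] (mod int p)"
    by (rule central_trinomial_lucas[OF p b])
  also have "[central_trinomial (m * p ^ l + a) * central_trinomial b =
      (central_trinomial m * central_trinomial a) * central_trinomial b] (mod int p)"
    by (intro cong_mult Suc.IH a cong_refl)
  also have "(central_trinomial m * central_trinomial a) * central_trinomial b =
      central_trinomial m * (central_trinomial a * central_trinomial b)"
    by simp
  also have "[central_trinomial m * (central_trinomial a * central_trinomial b) =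
      central_trinomial m * central_trinomial (a * p + b)] (mod int p)"
    by (intro cong_scalar_left cong_sym[OF central_trinomial_lucas[OF p b]])
  finally show ?case
    by (simp add: k algebra_simps)
qed simp

lemma central_trinomial_mult_prime:
  assumes "prime p"
  shows "[central_trinomial (m * p) = central_trinomial m] (mod int p)"
  using central_trinomial_lucas[OF assms prime_gt_0_nat[OF assms], of m] by simp

section \<open>The reflection k -> p-1-k modulo p\<close>

lemma central_trinomial_recurrence':
  assumes "n > 0"
  shows "int (n + 1) * central_trinomial (n + 1) =
     int (2 * n + 1) * central_trinomial n + 3 * int n * central_trinomial (n - 1)"
proof -
  obtain n' where "n = Suc n'" using assms by (cases n) auto
  then show ?thesis using central_trinomial_recurrence[of n'] by simp
qed

text \<open>Modulo p, the three-term recurrence read downwards from p-1 and weighted by (-3)^k is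
  the recurrence read upwards. Both sides agree for k = 0 and k = 1, and the leading coefficient k
  is a unit.\<close>

lemma central_trinomial_reflect:
  assumes p: "prime p" and "k < p"
  shows "[(- 3) ^ k * central_trinomial (p - 1 - k) =
          central_trinomial (p - 1) * central_trinomial k] (mod int p)"
  using \<open>k < p\<close>
proof (induction k rule: less_induct)
  case (less k)
  let ?T = central_trinomial
  have cancel: "[x = y] (mod int p)"
    if "[int (j + 1) * x = int (j + 1) * y] (mod int p)" "j + 1 < p" for x y j
  proof -
    have "\<not> int p dvd int (j + 1)"
      using that(2) unfolding int_dvd_int_iff by (auto dest: dvd_imp_le)
    then have "coprime (int (j + 1)) (int p)"
      using p by (metis coprime_commute prime_imp_coprime prime_nat_int_transfer)
    then show ?thesis
      using that(1) cong_mult_lcancel by blast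
  qed
  consider "k = 0" | "k = 1" | j where "k = j + 2"
    by (metis One_nat_def Suc_eq_plus1 add_2_eq_Suc' nat.exhaust)
  then show ?case
  proof cases
    case 1
    then show ?thesis by simp
  next
    case 2
    have p2: "p \<ge> 2" using prime_ge_2_nat[OF p] .
    \<comment> \<open>At this index the leading coefficient of the recurrence is p, so modulo p a
      relation between T_(p-1) and T_(p-2) remains.\<close>
    have "int p * ?T p = int (2 * p - 1) * ?T (p - 1) + 3 * int (p - 1) * ?T (p - 2)"
      using central_trinomial_recurrence[of "p - 2"] p2
      by (simp add: numeral_eq_Suc Suc_diff_Suc algebra_simps of_nat_diff)
    then have "(- 3) ^ k * ?T (p - 1 - k) - ?T (p - 1) * ?T k
        = int p * (?T p - 2 * ?T (p - 1) - 3 * ?T (p - 2))"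
      using 2 p2 by (simp add: of_nat_diff numeral_eq_Suc algebra_simps)
    then show ?thesis
      by (simp add: cong_iff_dvd_diff)
  next
    case (3 j)
    define n where "n = p - 1 - (j + 1)"
    have n: "n > 0" "p = n + j + 2"
      using 3 less.prems by (auto simp: n_def)
    have r1: "int (n + 1) * ?T (n + 1) = int (2 * n + 1) * ?T n + 3 * int n * ?T (n - 1)"
      by (rule central_trinomial_recurrence'[OF n(1)])
    have r2: "int (j + 2) * ?T (j + 2) = int (2 * j + 3) * ?T (j + 1) + 3 * int (j + 1) * ?T j"
      by (rule central_trinomial_recurrence)
    let ?e = "?T (p - 1)"
    have i0: "[(- 3) ^ j * ?T (n + 1) = ?e * ?T j] (mod int p)"
      using less.IH[of j] 3 less.prems n by simp
    have i1: "[(- 3) ^ (j + 1) * ?T n = ?e * ?T (j + 1)] (mod int p)"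
      using less.IH[of "j + 1"] 3 less.prems n by simp
    \<comment> \<open>Modulo p, n is -(j+2); the summands with the factor \<open>int p\<close> are
      the exact error of this substitution in \<open>r1\<close>.\<close>
    have "int (j + 2) * ((- 3) ^ (j + 2) * ?T (n - 1))
       = (3 * int (j + 1)) * ((- 3) ^ j * ?T (n + 1)) + int (2 * j + 3) * ((- 3) ^ (j + 1) * ?T n)
         + int p * (- 3) ^ (j + 1) * (- 3 * ?T (n - 1) - 2 * ?T n)
         + int p * (- 3) ^ (j + 1) * ?T (n + 1)" (is "?lhs = ?rhs")
    proof -
      have p_eq: "int p = int n + int j + 2" using n by simp
      have "?lhs - ?rhs = 3 * (- 3) ^ j * (int (n + 1) * ?T (n + 1)
          - (int (2 * n + 1) * ?T n + 3 * int n * ?T (n - 1)))"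
        unfolding p_eq by (simp add: algebra_simps power_add)
      then show ?thesis
        unfolding r1 by simp
    qed
    then have "[int (j + 2) * ((- 3) ^ (j + 2) * ?T (n - 1))
       = (3 * int (j + 1)) * ((- 3) ^ j * ?T (n + 1)) + int (2 * j + 3) * ((- 3) ^ (j + 1) * ?T n)] (mod int p)"
      by (simp add: cong_iff_dvd_diff)
    also have "[(3 * int (j + 1)) * ((- 3) ^ j * ?T (n + 1)) + int (2 * j + 3) * ((- 3) ^ (j + 1) * ?T n)
       = (3 * int (j + 1)) * (?e * ?T j) + int (2 * j + 3) * (?e * ?T (j + 1))] (mod int p)"
      by (intro cong_add cong_scalar_left i0 i1)
    also have "(3 * int (j + 1)) * (?e * ?T j) + int (2 * j + 3) * (?e * ?T (j + 1)) = int (j + 2) * (?e * ?T (j + 2))"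
      using arg_cong[OF r2, of "\<lambda>x. ?e * x"] by (simp add: algebra_simps)
    finally have "[(- 3) ^ (j + 2) * ?T (n - 1) = ?e * ?T (j + 2)] (mod int p)"
      using cancel[of "j + 1"] 3 less.prems by (simp add: add.commute)
    then show ?thesis
      using 3 n by simp
  qed
qed

text \<open>Reflection at k = p-1 equates the square with (-3)^(p-1), which is 1 by Fermat since p
  does not divide 3.\<close>

lemma central_trinomial_last_sq:
  assumes p: "prime p" and "p > 3"
  shows "[central_trinomial (p - 1) * central_trinomial (p - 1) = 1] (mod int p)"
proof -
  have "\<not> p dvd 3"
    using \<open>p > 3\<close> by (auto dest: dvd_imp_le)
  then have "[3 ^ (p - 1) = 1] (mod p)"
    using p by (intro fermat_theorem) auto
  then have "[int (3 ^ (p - 1)) = int 1] (mod int p)"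
    by (simp only: cong_int_iff)
  moreover have "even (p - 1)"
    using prime_odd_nat[OF p] \<open>p > 3\<close> by simp
  ultimately have "[(- 3) ^ (p - 1) = (1 :: int)] (mod int p)"
    by simp
  moreover have "[(- 3) ^ (p - 1) = central_trinomial (p - 1) * central_trinomial (p - 1)] (mod int p)"
    using central_trinomial_reflect[OF p, of "p - 1"] \<open>p > 3\<close> by simp
  ultimately show ?thesis
    using cong_sym cong_trans by blast
qed

section \<open>Motzkin numbers split off by their last base-p digit\<close>

text \<open>The digits k, k+1 and k+2 all stay below p, so nothing carries and all three terms scale
  by T_m.\<close>

lemma two_motzkin_lucas_low:
  assumes p: "prime p" and k: "k < p - 2"
  shows "[2 * motzkin (m * p + k) = 2 * motzkin k * central_trinomial m] (mod int p)"
proof -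
  have "[central_trinomial (m * p + k) = central_trinomial m * central_trinomial k] (mod int p)"
       "[central_trinomial (m * p + k + 1) = central_trinomial m * central_trinomial (k + 1)] (mod int p)"
       "[central_trinomial (m * p + k + 2) = central_trinomial m * central_trinomial (k + 2)] (mod int p)"
    using central_trinomial_lucas[OF p, of k m] central_trinomial_lucas[OF p, of "k + 1" m]
      central_trinomial_lucas[OF p, of "k + 2" m] k by (simp_all add: add.assoc)
  then have "[2 * motzkin (m * p + k) =
      3 * (central_trinomial m * central_trinomial k)
      + 2 * (central_trinomial m * central_trinomial (k + 1))
      - central_trinomial m * central_trinomial (k + 2)] (mod int p)"
    unfolding two_motzkin by (intro cong_add cong_diff cong_scalar_left)
  also have "3 * (central_trinomial m * central_trinomial k)
      + 2 * (central_trinomial m * central_trinomial (k + 1))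
      - central_trinomial m * central_trinomial (k + 2) = 2 * motzkin k * central_trinomial m"
    unfolding two_motzkin by (simp add: algebra_simps)
  finally show ?thesis .
qed

text \<open>Only the index n+2 carries, producing T_(m+1). Reflection gives -3 T_(p-2) = T_(p-1),
  which merges the other two terms.\<close>

lemma two_motzkin_lucas_penultimate:
  assumes p: "prime p"
  shows "[2 * motzkin (m * p + (p - 2)) =
    central_trinomial (p - 1) * central_trinomial m - central_trinomial (m + 1)] (mod int p)"
proof -
  have p2: "p \<ge> 2" using p by (rule prime_ge_2_nat)
  define n where "n = m * p + (p - 2)"
  have n: "n + 1 = m * p + (p - 1)" "n + 2 = (m + 1) * p"
    using p2 by (auto simp: n_def)
  have "p - 1 - 1 = p - 2" by simp
  then have r: "[- 3 * central_trinomial (p - 2) = central_trinomial (p - 1)] (mod int p)"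
    using central_trinomial_reflect[OF p, of 1] p2 by simp
  have a: "[central_trinomial n = central_trinomial m * central_trinomial (p - 2)] (mod int p)"
    unfolding n_def by (rule central_trinomial_lucas[OF p]) (use p2 in auto)
  have "[central_trinomial (n + 1) = central_trinomial m * central_trinomial (p - 1)] (mod int p)"
    unfolding n by (rule central_trinomial_lucas[OF p]) (use p2 in auto)
  moreover have "[central_trinomial (n + 2) = central_trinomial (m + 1)] (mod int p)"
    unfolding n by (rule central_trinomial_mult_prime[OF p])
  ultimately have "[2 * motzkin n = 3 * (central_trinomial m * central_trinomial (p - 2))
      + 2 * (central_trinomial m * central_trinomial (p - 1)) - central_trinomial (m + 1)] (mod int p)"
    unfolding two_motzkin using a by (intro cong_add cong_diff cong_scalar_left)
  also have "3 * (central_trinomial m * central_trinomial (p - 2))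
      + 2 * (central_trinomial m * central_trinomial (p - 1)) - central_trinomial (m + 1) =
      2 * (central_trinomial m * central_trinomial (p - 1)) - central_trinomial (m + 1)
      - central_trinomial m * (- 3 * central_trinomial (p - 2))"
    by simp
  also have "[2 * (central_trinomial m * central_trinomial (p - 1)) - central_trinomial (m + 1)
      - central_trinomial m * (- 3 * central_trinomial (p - 2)) =
      2 * (central_trinomial m * central_trinomial (p - 1)) - central_trinomial (m + 1)
      - central_trinomial m * central_trinomial (p - 1)] (mod int p)"
    by (intro cong_diff cong_scalar_left r cong_refl)
  finally show ?thesis
    by (simp add: n_def algebra_simps)
qed

text \<open>Both n+1 and n+2 carry, to last digits 0 and 1, where T_0 = T_1 = 1.\<close>

lemma two_motzkin_lucas_last:
  assumes p: "prime p"
  shows "[2 * motzkin (m * p + (p - 1)) =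
    3 * central_trinomial (p - 1) * central_trinomial m + central_trinomial (m + 1)] (mod int p)"
proof -
  have p2: "p \<ge> 2" using p by (rule prime_ge_2_nat)
  define n where "n = m * p + (p - 1)"
  have n: "n + 1 = (m + 1) * p" "n + 2 = (m + 1) * p + 1"
    using p2 by (auto simp: n_def)
  have "[central_trinomial n = central_trinomial m * central_trinomial (p - 1)] (mod int p)"
    unfolding n_def by (rule central_trinomial_lucas[OF p]) (use p2 in auto)
  moreover have "[central_trinomial (n + 1) = central_trinomial (m + 1)] (mod int p)"
    unfolding n by (rule central_trinomial_mult_prime[OF p])
  moreover have "[central_trinomial (n + 2) = central_trinomial (m + 1)] (mod int p)"
    using central_trinomial_lucas[OF p, of 1 "m + 1"] p2 unfolding n by simp
  ultimately have "[2 * motzkin n = 3 * (central_trinomial m * central_trinomial (p - 1))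
      + 2 * central_trinomial (m + 1) - central_trinomial (m + 1)] (mod int p)"
    unfolding two_motzkin by (intro cong_add cong_diff cong_scalar_left)
  then show ?thesis
    by (simp add: n_def algebra_simps)
qed

section \<open>Asymptotic density\<close>

text \<open>A one-sided o(N). The additive constant absorbs small N, so no "eventually" has to be
  carried through sums and recursions.\<close>

definition sublinear :: "(nat \<Rightarrow> real) \<Rightarrow> bool" where
  "sublinear g \<longleftrightarrow> (\<forall>e>0. \<exists>K. \<forall>N. g N \<le> e * real N + K)"

lemma sublinearI: "(\<And>e. e > 0 \<Longrightarrow> \<exists>K. \<forall>N. g N \<le> e * real N + K) \<Longrightarrow> sublinear g"
  by (simp add: sublinear_def)

lemma sublinearD: "sublinear g \<Longrightarrow> e > 0 \<Longrightarrow> \<exists>K. \<forall>N. g N \<le> e * real N + K"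
  by (simp add: sublinear_def)

lemma sublinear_mono:
  assumes "sublinear g" "\<And>N. f N \<le> g N"
  shows "sublinear f"
  using assms unfolding sublinear_def by (meson order_trans)

lemma sublinear_const: "sublinear (\<lambda>N. c)"
  by (rule sublinearI) (intro exI[of _ c], auto)

lemma sublinear_add:
  assumes "sublinear f" "sublinear g"
  shows "sublinear (\<lambda>N. f N + g N)"
proof (rule sublinearI)
  fix e :: real assume "e > 0"
  then obtain K L where "\<forall>N. f N \<le> e / 2 * real N + K" "\<forall>N. g N \<le> e / 2 * real N + L"
    using assms by (meson sublinearD half_gt_zero)
  then have "\<forall>N. f N + g N \<le> e * real N + (K + L)"
    by (auto simp: field_simps intro: add_mono) (smt (verit) field_sum_of_halves distrib_right)
  then show "\<exists>K. \<forall>N. f N + g N \<le> e * real N + K" ..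
qed

lemma sublinear_sum:
  assumes "\<And>i. i \<in> I \<Longrightarrow> sublinear (f i)"
  shows "sublinear (\<lambda>N. \<Sum>i\<in>I. f i N)"
  using assms by (induction I rule: infinite_finite_induct)
    (auto intro: sublinear_const sublinear_add)

lemma sublinear_div:
  assumes "sublinear f"
  shows "sublinear (\<lambda>N. f (N div q))"
proof (rule sublinearI)
  fix e :: real assume e: "e > 0"
  then obtain K where K: "\<forall>N. f N \<le> e * real N + K"
    using assms by (meson sublinearD)
  have "f (N div q) \<le> e * real N + K" for N
  proof -
    have "e * real (N div q) \<le> e * real N"
      using e by (intro mult_left_mono) auto
    then show ?thesis using K[rule_format, of "N div q"] by linarith
  qed
  then show "\<exists>K. \<forall>N. f (N div q) \<le> e * real N + K" by blast
qed

text \<open>Iterating the recursion \<open>k\<close> times improves a linear bound \<open>B N\<close> to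
  \<open>((r/q)\<^sup>k B + e/(1 - r/q)) N + O(1)\<close>.\<close>
lemma sublinear_contraction:
  assumes r: "0 \<le> r" "r < real q" and h: "sublinear h"
    and step: "\<And>N. g N \<le> r * g (N div q) + h N"
    and B: "\<And>N. g N \<le> B * real N"
  shows "sublinear g"
proof (rule sublinearI)
  fix e :: real assume e: "e > 0"
  define \<rho> where "\<rho> = r / real q"
  have \<rho>: "0 \<le> \<rho>" "\<rho> < 1" using r by (auto simp: \<rho>_def)
  \<comment> \<open>Chosen so that e/2 is the fixed point of the slope recursion t -> rho t +
    delta.\<close>
  define \<delta> where "\<delta> = e / 2 * (1 - \<rho>)"
  have \<delta>: "\<delta> > 0" using e \<rho> by (simp add: \<delta>_def)
  obtain H where H: "\<And>N. h N \<le> \<delta> * real N + H"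
    using sublinearD[OF h \<delta>] by blast
  define B' where "B' = max B 0"
  have bound: "\<exists>K. \<forall>N. g N \<le> (\<rho> ^ k * B' + e / 2) * real N + K" for k
  proof (induction k)
    case 0
    have "B * real N \<le> (B' + e / 2) * real N" for N
      using e by (intro mult_right_mono) (auto simp: B'_def)
    then have "g N \<le> (B' + e / 2) * real N" for N
      using B order_trans by blast
    then show ?case by (intro exI[of _ 0]) simp
  next
    case (Suc k)
    then obtain K where K: "\<And>N. g N \<le> (\<rho> ^ k * B' + e / 2) * real N + K" by blast
    define \<beta> where "\<beta> = \<rho> ^ k * B' + e / 2"
    have \<beta>: "\<beta> \<ge> 0" using \<rho> e by (auto simp: \<beta>_def B'_def)
    have "g N \<le> (\<rho> ^ Suc k * B' + e / 2) * real N + (r * K + H)" for N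
    proof -
      have "g N \<le> r * g (N div q) + h N" by (rule step)
      also have "\<dots> \<le> r * (\<beta> * real (N div q) + K) + (\<delta> * real N + H)"
        using K H r by (intro add_mono mult_left_mono) (auto simp: \<beta>_def)
      also have "\<beta> * real (N div q) \<le> \<beta> * (real N / real q)"
        using \<beta> by (intro mult_left_mono of_nat_div_le_of_nat)
      then have "r * (\<beta> * real (N div q) + K) + (\<delta> * real N + H)
          \<le> r * (\<beta> * (real N / real q) + K) + (\<delta> * real N + H)"
        by (rule add_right_mono[OF mult_left_mono[OF add_right_mono]]) (rule r(1))
      also have "\<dots> = (\<rho> * \<beta> + \<delta>) * real N + (r * K + H)"
        by (simp add: \<rho>_def algebra_simps)
      also have "\<rho> * \<beta> + \<delta> = \<rho> ^ Suc k * B' + e / 2"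
        by (simp add: \<beta>_def \<delta>_def field_simps)
      finally show ?thesis .
    qed
    then show ?case by blast
  qed
  have "(\<lambda>k. \<rho> ^ k * B') \<longlonglongrightarrow> 0"
    using \<rho> by (intro tendsto_mult_left_zero LIMSEQ_power_zero) auto
  then have "\<forall>\<^sub>F k in sequentially. \<rho> ^ k * B' < e / 2"
    using e by (intro order_tendstoD(2)) auto
  then obtain k where k: "\<rho> ^ k * B' < e / 2"
    by (auto simp: eventually_sequentially)
  obtain K where K: "\<And>N. g N \<le> (\<rho> ^ k * B' + e / 2) * real N + K"
    using bound by blast
  have "g N \<le> e * real N + K" for N
  proof -
    have "(\<rho> ^ k * B' + e / 2) * real N \<le> e * real N"
      using k by (intro mult_right_mono) auto
    then show ?thesis using K[of N] by linarith
  qed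
  then show "\<exists>K. \<forall>N. g N \<le> e * real N + K" by blast
qed

section \<open>Counting functions and residue sections\<close>

abbreviation count_below :: "nat set \<Rightarrow> nat \<Rightarrow> nat" where
  "count_below S N \<equiv> card (S \<inter> {n. n < N})"

lemma count_below_le: "count_below S N \<le> N"
proof -
  have "count_below S N \<le> card {n. n < N}"
    by (intro card_mono) auto
  then show ?thesis by simp
qed

text \<open>Recasts the limit as an error bound, the form to which recursions in N div q and the
  contraction argument apply.\<close>

lemma has_asymp_density_iff_sublinear:
  "has_asymp_density S d \<longleftrightarrow> sublinear (\<lambda>N. \<bar>real (count_below S N) - d * real N\<bar>)"
proof
  assume L: "has_asymp_density S d"
  show "sublinear (\<lambda>N. \<bar>real (count_below S N) - d * real N\<bar>)"
  proof (rule sublinearI)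
    fix e :: real assume e: "e > 0"
    from L e obtain M where M: "\<And>N. N \<ge> M \<Longrightarrow> \<bar>real (count_below S N) / real N - d\<bar> < e"
      unfolding has_asymp_density_def lim_sequentially dist_real_def by blast
    \<comment> \<open>The trivial error bound for N up to M, including N = 0.\<close>
    define K where "K = (1 + \<bar>d\<bar>) * real M"
    have "\<bar>real (count_below S N) - d * real N\<bar> \<le> e * real N + K" for N
    proof (cases "N \<ge> M \<and> N > 0")
      case True
      then have "\<bar>real (count_below S N) / real N - d\<bar> * \<bar>real N\<bar> \<le> e * real N"
        using M[of N] by (intro mult_mono) auto
      then have "\<bar>(real (count_below S N) / real N - d) * real N\<bar> \<le> e * real N"
        by (simp only: abs_mult)
      moreover have "(real (count_below S N) / real N - d) * real N = real (count_below S N) - d * real N"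
        using True by (simp add: field_simps)
      moreover have "K \<ge> 0" by (simp add: K_def)
      ultimately show ?thesis by simp
    next
      case False
      then have N: "N \<le> M" by auto
      have "\<bar>real (count_below S N) - d * real N\<bar> \<le> real N + \<bar>d\<bar> * real N"
        using count_below_le[of S N] abs_triangle_ineq4[of "real (count_below S N)" "d * real N"]
        by (simp add: abs_mult)
      also have "\<dots> = (1 + \<bar>d\<bar>) * real N" by (simp add: algebra_simps)
      also have "\<dots> \<le> K" using N unfolding K_def by (intro mult_left_mono) auto
      finally have "\<bar>real (count_below S N) - d * real N\<bar> \<le> K" .
      moreover have "e * real N \<ge> 0" using e by simp
      ultimately show ?thesis by linarith
    qed
    then show "\<exists>K. \<forall>N. \<bar>real (count_below S N) - d * real N\<bar> \<le> e * real N + K" by blast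
  qed
next
  assume S: "sublinear (\<lambda>N. \<bar>real (count_below S N) - d * real N\<bar>)"
  show "has_asymp_density S d"
    unfolding has_asymp_density_def lim_sequentially dist_real_def
  proof (intro allI impI)
    fix e :: real assume e: "e > 0"
    obtain K where K: "\<And>N. \<bar>real (count_below S N) - d * real N\<bar> \<le> e / 2 * real N + K"
      using sublinearD[OF S, of "e / 2"] e by auto
    obtain M :: nat where M: "real M > 2 * K / e" using reals_Archimedean2 by blast
    have "\<bar>real (count_below S N) / real N - d\<bar> < e" if "N \<ge> Suc M" for N
    proof -
      have N: "real N > 0" "real N > 2 * K / e" using that M by auto
      then have "K < e / 2 * real N" using e by (simp add: field_simps)
      then have "\<bar>real (count_below S N) - d * real N\<bar> < e * real N"
        using K[of N] by linarith
      moreover have "real (count_below S N) / real N - d = (real (count_below S N) - d * real N) / real N"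
        using N by (simp add: field_simps)
      ultimately show ?thesis
        using N by (simp add: abs_divide divide_less_eq)
    qed
    then show "\<exists>M. \<forall>N\<ge>M. \<bar>real (count_below S N) / real N - d\<bar> < e" by blast
  qed
qed

text \<open>Decimation along one residue class, the operation that generates the q-kernel of an
  automatic sequence.\<close>

definition residue_section :: "nat \<Rightarrow> nat \<Rightarrow> nat set \<Rightarrow> nat set" where
  "residue_section q j S = {m. m * q + j \<in> S}"

lemma count_below_mult:
  "count_below S (q * M) = (\<Sum>j<q. count_below (residue_section q j S) M)"
proof -
  let ?A = "SIGMA j:{..<q}. residue_section q j S \<inter> {m. m < M}"
  let ?f = "\<lambda>(j, m). m * q + j"
  have "card ?A = (\<Sum>j<q. count_below (residue_section q j S) M)"
    by (intro card_SigmaI) auto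
  moreover have "bij_betw ?f ?A (S \<inter> {n. n < q * M})"
  proof (rule bij_betwI[where g = "\<lambda>n. (n mod q, n div q)"])
    show "?f \<in> ?A \<rightarrow> S \<inter> {n. n < q * M}"
    proof clarsimp
      fix j m assume *: "j < q" "m \<in> residue_section q j S" "m < M"
      have "m * q + j < (m + 1) * q" using * by simp
      also have "\<dots> \<le> M * q" using * by (intro mult_right_mono) auto
      finally show "m * q + j \<in> S \<and> m * q + j < q * M"
        using * by (simp add: residue_section_def mult.commute)
    qed
    show "(\<lambda>n. (n mod q, n div q)) \<in> S \<inter> {n. n < q * M} \<rightarrow> ?A"
      by (auto simp: residue_section_def less_mult_imp_div_less mult.commute intro!: mod_less_divisor)
        (metis gr_zeroI less_nat_zero_code mult_0 mult_0_right mult.commute)+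
  qed auto
  then have "card ?A = count_below S (q * M)"
    by (rule bij_betw_same_card)
  ultimately show ?thesis by simp
qed

lemma count_below_div_bounds:
  assumes "q > 0"
  shows "(\<Sum>j<q. count_below (residue_section q j S) (N div q)) \<le> count_below S N"
    and "count_below S N \<le> (\<Sum>j<q. count_below (residue_section q j S) (N div q)) + q"
proof -
  have le: "q * (N div q) \<le> N" by simp
  show "(\<Sum>j<q. count_below (residue_section q j S) (N div q)) \<le> count_below S N"
    unfolding count_below_mult[symmetric] using le by (intro card_mono) (auto intro: less_le_trans)
  have "S \<inter> {n. n < N} \<subseteq> (S \<inter> {n. n < q * (N div q)}) \<union> {q * (N div q)..<N}"
    by auto
  then have "count_below S N \<le> card ((S \<inter> {n. n < q * (N div q)}) \<union> {q * (N div q)..<N})"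
    by (intro card_mono) auto
  also have "\<dots> \<le> count_below S (q * (N div q)) + card {q * (N div q)..<N}"
    by (rule card_Un_le)
  also have "card {q * (N div q)..<N} \<le> q"
    using assms by (simp add: minus_mult_div_eq_mod less_imp_le)
  finally show "count_below S N \<le> (\<Sum>j<q. count_below (residue_section q j S) (N div q)) + q"
    by (simp add: count_below_mult)
qed

text \<open>The incomplete last block costs at most q elements, and replacing N/q by N div q costs
  at most the absolute sum of the d j. The section errors stay signed so that they can cancel in the
  equidistribution argument.\<close>

lemma count_below_error:
  fixes d :: "nat \<Rightarrow> real"
  assumes "q > 0"
  shows "\<bar>(real (count_below S N) - (\<Sum>j<q. d j) / real q * real N)
      - (\<Sum>j<q. real (count_below (residue_section q j S) (N div q)) - d j * real (N div q))\<bar>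
      \<le> real q + \<bar>\<Sum>j<q. d j\<bar>"
proof -
  define D where "D = (\<Sum>j<q. d j)"
  define A where "A = (\<Sum>j<q. real (count_below (residue_section q j S) (N div q)))"
  have "real (\<Sum>j<q. count_below (residue_section q j S) (N div q)) = A"
    by (simp add: A_def)
  then have A: "A \<le> real (count_below S N)" "real (count_below S N) \<le> A + real q"
    using count_below_div_bounds[OF assms, of S N] by linarith+
  have "real N / real q - real (N div q) \<ge> 0" "real N / real q - real (N div q) \<le> 1"
    using of_nat_of_nat_div_aux[of N q, where 'a = real] assms by (simp_all add: less_imp_le)
  then have "\<bar>D * (real N / real q - real (N div q))\<bar> \<le> \<bar>D\<bar> * 1"
    unfolding abs_mult by (intro mult_left_mono) auto
  moreover have "(\<Sum>j<q. real (count_below (residue_section q j S) (N div q)) - d j * real (N div q))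
      = A - D * real (N div q)"
    by (simp add: A_def D_def sum_subtractf sum_distrib_right)
  ultimately show ?thesis
    using A unfolding D_def[symmetric] by (simp add: algebra_simps)
qed

lemma count_below_error_abs:
  fixes d :: "nat \<Rightarrow> real"
  assumes "q > 0"
  shows "\<bar>real (count_below S N) - (\<Sum>j<q. d j) / real q * real N\<bar>
      \<le> (\<Sum>j<q. \<bar>real (count_below (residue_section q j S) (N div q)) - d j * real (N div q)\<bar>)
        + (real q + \<bar>\<Sum>j<q. d j\<bar>)"
proof -
  have "\<bar>\<Sum>j<q. real (count_below (residue_section q j S) (N div q)) - d j * real (N div q)\<bar>
      \<le> (\<Sum>j<q. \<bar>real (count_below (residue_section q j S) (N div q)) - d j * real (N div q)\<bar>)"
    by (rule sum_abs)
  then show ?thesis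
    using count_below_error[OF assms, of S N d] by linarith
qed

lemma has_asymp_density_sections:
  assumes "q > 0" and "\<And>j. j < q \<Longrightarrow> has_asymp_density (residue_section q j S) (d j)"
  shows "has_asymp_density S ((\<Sum>j<q. d j) / real q)"
  unfolding has_asymp_density_iff_sublinear
proof (rule sublinear_mono[OF _ count_below_error_abs[OF assms(1)]])
  show "sublinear (\<lambda>N. (\<Sum>j<q. \<bar>real (count_below (residue_section q j S) (N div q)) - d j * real (N div q)\<bar>)
        + (real q + \<bar>\<Sum>j<q. d j\<bar>))"
    using assms(2) unfolding has_asymp_density_iff_sublinear
    by (intro sublinear_add sublinear_const sublinear_sum) 
       (rule sublinear_div[where f = "\<lambda>N. \<bar>real (count_below (residue_section q _ S) N) - d _ * real N\<bar>"], auto)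
qed

text \<open>The last section reproduces the error of S itself at N div q, a contraction with factor
  1 against q. The density D is forced by q D = D + (sum of the other densities).\<close>

lemma has_asymp_density_self_similar:
  assumes q: "q > 1" and self: "residue_section q (q - 1) S = S"
    and d: "\<And>j. j < q - 1 \<Longrightarrow> has_asymp_density (residue_section q j S) (d j)"
  shows "has_asymp_density S ((\<Sum>j<q-1. d j) / (real q - 1))"
proof -
  define D where "D = (\<Sum>j<q-1. d j) / (real q - 1)"
  \<comment> \<open>Giving the self-similar class the sought density makes the average over all q
    classes equal to D.\<close>
  define d' where "d' = d(q - 1 := D)"
  have split: "{..<q} = insert (q - 1) {..<q - 1}" using q by auto
  have "(\<Sum>j<q. d' j) = D + (\<Sum>j<q-1. d j)"
    unfolding split by (simp add: d'_def)
  also have "\<dots> = D * real q"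
    using q by (simp add: D_def field_simps)
  finally have D: "(\<Sum>j<q. d' j) / real q = D" using q by simp
  define g where "g = (\<lambda>N. \<bar>real (count_below S N) - D * real N\<bar>)"
  define h where "h = (\<lambda>N. (\<Sum>j<q-1. \<bar>real (count_below (residue_section q j S) (N div q)) - d j * real (N div q)\<bar>)
        + (real q + \<bar>\<Sum>j<q. d' j\<bar>))"
  have "sublinear g"
  proof (rule sublinear_contraction[where r = 1 and q = q and h = h and B = "1 + \<bar>D\<bar>"])
    show "sublinear h"
      unfolding h_def
    proof (intro sublinear_add sublinear_const sublinear_sum)
      fix j assume "j \<in> {..<q - 1}"
      then show "sublinear (\<lambda>N. \<bar>real (count_below (residue_section q j S) (N div q)) - d j * real (N div q)\<bar>)"
        using d[of j] unfolding has_asymp_density_iff_sublinear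
        by (intro sublinear_div[where f = "\<lambda>N. \<bar>real (count_below (residue_section q j S) N) - d j * real N\<bar>"]) auto
    qed
    show "g N \<le> 1 * g (N div q) + h N" for N
      using count_below_error_abs[of q S N d'] q unfolding D
      unfolding split g_def h_def by (simp add: self[unfolded One_nat_def] d'_def)
    show "g N \<le> (1 + \<bar>D\<bar>) * real N" for N
      using count_below_le[of S N] abs_triangle_ineq4[of "real (count_below S N)" "D * real N"]
      by (simp add: g_def abs_mult algebra_simps)
  qed (use q in auto)
  then show ?thesis
    unfolding has_asymp_density_iff_sublinear g_def D_def .
qed

section \<open>Closure rules for densities\<close>

lemma has_asymp_density_empty: "has_asymp_density {} 0"
  by (simp add: has_asymp_density_iff_sublinear sublinear_const)

lemma has_asymp_density_UNIV: "has_asymp_density UNIV 1"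
  by (simp add: has_asymp_density_iff_sublinear sublinear_const)

lemma has_asymp_density_subset_0:
  assumes "has_asymp_density S 0" "T \<subseteq> S"
  shows "has_asymp_density T 0"
  using assms(1) unfolding has_asymp_density_iff_sublinear
  by (rule sublinear_mono) (use assms(2) in \<open>auto intro!: card_mono\<close>)

lemma has_asymp_density_compl:
  assumes "has_asymp_density S d"
  shows "has_asymp_density (- S) (1 - d)"
proof -
  have "real (count_below (- S) N) - (1 - d) * real N = - (real (count_below S N) - d * real N)" for N
  proof -
    have "card {n. n < N} = card ((S \<inter> {n. n < N}) \<union> (- S \<inter> {n. n < N}))"
      by (rule arg_cong[where f = card]) auto
    also have "\<dots> = count_below S N + count_below (- S) N"
      by (intro card_Un_disjoint) auto
    finally have "N = count_below S N + count_below (- S) N" by simp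
    then have "real N = real (count_below S N) + real (count_below (- S) N)"
      by (metis of_nat_add)
    then show ?thesis by (simp add: algebra_simps)
  qed
  then show ?thesis
    using assms unfolding has_asymp_density_iff_sublinear by (simp add: abs_minus_commute)
qed

lemma has_asymp_density_Un_0:
  assumes "has_asymp_density S 0" "has_asymp_density T 0"
  shows "has_asymp_density (S \<union> T) 0"
proof -
  have "sublinear (\<lambda>N. \<bar>real (count_below S N) - 0 * real N\<bar> + \<bar>real (count_below T N) - 0 * real N\<bar>)"
    using assms unfolding has_asymp_density_iff_sublinear by (rule sublinear_add)
  moreover have "count_below (S \<union> T) N \<le> count_below S N + count_below T N" for N
    using card_Un_le[of "S \<inter> {n. n < N}" "T \<inter> {n. n < N}"] by (simp add: Int_Un_distrib2)
  then have "real (count_below (S \<union> T) N) \<le> real (count_below S N) + real (count_below T N)" for N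
    by (metis of_nat_add of_nat_le_iff)
  ultimately show ?thesis
    unfolding has_asymp_density_iff_sublinear by (elim sublinear_mono) simp
qed

lemma has_asymp_density_Suc_0:
  assumes "has_asymp_density S 0"
  shows "has_asymp_density {n. Suc n \<in> S} 0"
proof -
  have "sublinear (\<lambda>N. \<bar>real (count_below S N) - 0 * real N\<bar> + 1)"
    using assms unfolding has_asymp_density_iff_sublinear
    by (intro sublinear_add sublinear_const)
  moreover have "count_below {n. Suc n \<in> S} N \<le> count_below S N + 1" for N
  proof -
    have "count_below {n. Suc n \<in> S} N = card (Suc ` ({n. Suc n \<in> S} \<inter> {n. n < N}))"
      by (simp add: card_image)
    also have "\<dots> \<le> card (insert N (S \<inter> {n. n < N}))"
      by (intro card_mono) auto
    also have "\<dots> \<le> count_below S N + 1"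
      by (simp add: card_insert_if)
    finally show ?thesis .
  qed
  then have "real (count_below {n. Suc n \<in> S} N) \<le> real (count_below S N) + 1" for N
    by (metis of_nat_1 of_nat_add of_nat_le_iff)
  ultimately show ?thesis
    unfolding has_asymp_density_iff_sublinear by (elim sublinear_mono) simp
qed

section \<open>Densities of Motzkin numbers modulo a prime\<close>

lemma prime_dvd_mult_int_iff:
  "prime p \<Longrightarrow> int p dvd a * b \<longleftrightarrow> int p dvd a \<or> int p dvd b"
  by (intro prime_dvd_mult_iff) simp

lemma coprime_int_prime_iff:
  assumes "prime p"
  shows "coprime a (int p) \<longleftrightarrow> \<not> int p dvd a"
proof -
  have "prime (int p)" using assms by simp
  then show ?thesis
    by (metis coprime_absorb_right coprime_commute not_prime_unit prime_imp_coprime)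
qed

lemma prime_gt_2_not_dvd_2: "p > 2 \<Longrightarrow> \<not> int p dvd 2"
  by (auto dest: zdvd_imp_le)

lemma prime_gt_3_not_dvd_3: "p > 3 \<Longrightarrow> \<not> int p dvd 3"
  by (auto dest: zdvd_imp_le)

text \<open>Together with \<open>motzkin_digit_beta\<close>, the coefficients of the linear form in
  T_m and T_(m+1) attached to the last digit k; only the digits p-2 and p-1 involve a carry into
  m+1.\<close>

definition motzkin_digit_alpha :: "nat \<Rightarrow> nat \<Rightarrow> int" where
  "motzkin_digit_alpha p k =
    (if k = p - 2 then central_trinomial (p - 1)
     else if k = p - 1 then 3 * central_trinomial (p - 1)
     else 2 * motzkin k)"

definition motzkin_digit_beta :: "nat \<Rightarrow> nat \<Rightarrow> int" where
  "motzkin_digit_beta p k = (if k = p - 2 then - 1 else if k = p - 1 then 1 else 0)"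

lemma two_motzkin_lucas:
  assumes p: "prime p" and k: "k < p"
  shows "[2 * motzkin (m * p + k) =
    motzkin_digit_alpha p k * central_trinomial m
    + motzkin_digit_beta p k * central_trinomial (m + 1)] (mod int p)"
proof -
  have p2: "p \<ge> 2" using p by (rule prime_ge_2_nat)
  consider "k < p - 2" | "k = p - 2" | "k = p - 1" using k by linarith
  then show ?thesis
  proof cases
    case 1
    then have "k \<noteq> p - 2" "k \<noteq> p - 1" by auto
    then show ?thesis
      using two_motzkin_lucas_low[OF p 1, of m]
      by (simp add: motzkin_digit_alpha_def motzkin_digit_beta_def)
  next
    case 2
    then show ?thesis
      using two_motzkin_lucas_penultimate[OF p, of m]
      by (simp add: motzkin_digit_alpha_def motzkin_digit_beta_def)
  next
    case 3
    then have "k \<noteq> p - 2" using p2 by auto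
    then show ?thesis
      using two_motzkin_lucas_last[OF p, of m] 3
      by (simp add: motzkin_digit_alpha_def motzkin_digit_beta_def)
  qed
qed

section \<open>The case in which p divides some T_j with j < p\<close>

text \<open>By Lucas, the section at \<open>j0\<close> is empty and every other section lies in S,
  so the count contracts with factor p-1 against p.\<close>

lemma central_trinomial_nonzero_density:
  assumes p: "prime p" and j0: "j0 < p" "int p dvd central_trinomial j0"
  shows "has_asymp_density {n. \<not> int p dvd central_trinomial n} 0"
proof -
  define S where "S = {n. \<not> int p dvd central_trinomial n}"
  have p0: "p > 0" using prime_gt_0_nat[OF p] .
  have sec: "residue_section p j S \<subseteq> (if j = j0 then {} else S)" if "j < p" for j
  proof -
    have "int p dvd central_trinomial (m * p + j) \<longleftrightarrow>
        int p dvd central_trinomial m \<or> int p dvd central_trinomial j" for m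
      using cong_dvd_iff[OF central_trinomial_lucas[OF p that]] prime_dvd_mult_int_iff[OF p] by blast
    then show ?thesis using j0 by (auto simp: residue_section_def S_def)
  qed
  have "sublinear (\<lambda>N. real (count_below S N))"
  proof (rule sublinear_contraction[where r = "real (p - 1)" and q = p and B = 1])
    show "real (p - 1) < real p" using p0 by simp
    show "sublinear (\<lambda>N. real p)" by (rule sublinear_const)
    show "real (count_below S N) \<le> 1 * real N" for N
      using count_below_le[of S N] by simp
    fix N
    have "count_below S N \<le> (\<Sum>j<p. count_below (residue_section p j S) (N div p)) + p"
      by (rule count_below_div_bounds(2)[OF p0])
    also have "(\<Sum>j<p. count_below (residue_section p j S) (N div p))
        = (\<Sum>j\<in>{..<p}-{j0}. count_below (residue_section p j S) (N div p))"
      using sec[of j0] j0 by (intro sum.mono_neutral_right) auto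
    also have "\<dots> \<le> (\<Sum>j\<in>{..<p}-{j0}. count_below S (N div p))"
      using sec by (intro sum_mono card_mono) force+
    also have "\<dots> = (p - 1) * count_below S (N div p)"
      using j0 by simp
    finally have "count_below S N \<le> (p - 1) * count_below S (N div p) + p" by simp
    then show "real (count_below S N) \<le> real (p - 1) * real (count_below S (N div p)) + real p"
      by (metis of_nat_add of_nat_le_iff of_nat_mult)
  qed simp
  then show ?thesis
    by (simp add: has_asymp_density_iff_sublinear S_def)
qed

text \<open>On each last digit, 2 M_n is a combination of T_m and T_(m+1), which both vanish modulo
  p outside a set of density 0.\<close>

lemma motzkin_zero_density_1:
  assumes p: "prime p" and j0: "j0 < p" "int p dvd central_trinomial j0"
  shows "value_density_mod p motzkin 0 1"
proof -
  \<comment> \<open>The prime 2 cannot occur here because T_0 = T_1 = 1.\<close>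
  have p2: "p > 2"
  proof (rule ccontr)
    assume "\<not> p > 2"
    with prime_ge_2_nat[OF p] j0 have "p = 2" "j0 = 0 \<or> j0 = 1" by auto
    with j0 show False by auto
  qed
  define Z where "Z = {n. \<not> int p dvd central_trinomial n}"
  have Z: "has_asymp_density (Z \<union> {n. Suc n \<in> Z}) 0"
    unfolding Z_def
    by (intro has_asymp_density_Un_0 has_asymp_density_Suc_0 central_trinomial_nonzero_density[OF assms])
  define S where "S = {n. \<not> int p dvd motzkin n}"
  have "has_asymp_density (residue_section p k S) 0" if "k < p" for k
  proof (rule has_asymp_density_subset_0[OF Z], rule subsetI, rule ccontr)
    fix m assume m: "m \<in> residue_section p k S" "m \<notin> Z \<union> {n. Suc n \<in> Z}"
    then have "int p dvd motzkin_digit_alpha p k * central_trinomial m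
      + motzkin_digit_beta p k * central_trinomial (m + 1)"
      by (auto simp: Z_def intro!: dvd_add dvd_mult)
    then have "int p dvd 2 * motzkin (m * p + k)"
      using cong_dvd_iff[OF two_motzkin_lucas[OF p that]] by blast
    then have "int p dvd motzkin (m * p + k)"
      using prime_dvd_mult_int_iff[OF p] prime_gt_2_not_dvd_2[OF p2] by blast
    then show False using m by (simp add: residue_section_def S_def)
  qed
  then have "has_asymp_density S ((\<Sum>k<p. 0) / real p)"
    using p2 by (intro has_asymp_density_sections) auto
  then have "has_asymp_density (- S) 1"
    using has_asymp_density_compl[of S 0] by simp
  moreover have "- S = {n. motzkin n mod int p = 0}"
    by (auto simp: S_def mod_eq_0_iff_dvd)
  ultimately show ?thesis by (simp add: value_density_mod_def)
qed

lemma central_trinomial_nonvanishing: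
  assumes p: "prime p" and T: "\<forall>n<p. \<not> int p dvd central_trinomial n"
  shows "\<not> int p dvd central_trinomial n"
proof (induction n rule: less_induct)
  case (less n)
  show ?case
  proof (cases "n < p")
    case True
    then show ?thesis using T by blast
  next
    case False
    have "n = (n div p) * p + n mod p" by simp
    moreover have "n mod p < p" using prime_gt_0_nat[OF p] by simp
    moreover have "n div p < n"
      using False prime_gt_1_nat[OF p] by (intro div_less_dividend) auto
    ultimately show ?thesis
      using less.IH[of "n div p"] T cong_dvd_iff[OF central_trinomial_lucas[OF p, of "n mod p" "n div p"]]
        prime_dvd_mult_int_iff[OF p] by metis
  qed
qed

section \<open>Zeros and values of linear forms in T_n and T_(n+1)\<close>

definition trinomial_form :: "int \<Rightarrow> int \<Rightarrow> nat \<Rightarrow> int" where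
  "trinomial_form a b n = a * central_trinomial n + b * central_trinomial (n + 1)"

definition form_zeros :: "nat \<Rightarrow> int \<Rightarrow> int \<Rightarrow> nat \<Rightarrow> nat" where
  "form_zeros p a b N = count_below {n. int p dvd trinomial_form a b n} N"

text \<open>The bound on s keeps s+1 inside the low l digits, so no carry reaches m and T_m factors
  out.\<close>

lemma trinomial_form_lucas_power:
  assumes p: "prime p" and s: "s + 1 < p ^ l"
  shows "[trinomial_form a b (m * p ^ l + s) = central_trinomial m * trinomial_form a b s] (mod int p)"
proof -
  have "[central_trinomial (m * p ^ l + s) = central_trinomial m * central_trinomial s] (mod int p)"
       "[central_trinomial (m * p ^ l + s + 1) = central_trinomial m * central_trinomial (s + 1)] (mod int p)"
    using central_trinomial_lucas_power[OF p, of s l m]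
      central_trinomial_lucas_power[OF p, of "s + 1" l m] s by (simp_all add: add.assoc)
  then have "[trinomial_form a b (m * p ^ l + s) = a * (central_trinomial m * central_trinomial s)
      + b * (central_trinomial m * central_trinomial (s + 1))] (mod int p)"
    unfolding trinomial_form_def by (intro cong_add cong_scalar_left)
  then show ?thesis
    by (simp add: trinomial_form_def algebra_simps)
qed

lemma trinomial_form_lucas_last:
  assumes p: "prime p"
  shows "[trinomial_form a b (m * p + (p - 1)) =
    trinomial_form (a * central_trinomial (p - 1)) b m] (mod int p)"
proof -
  have p0: "p > 0" using prime_gt_0_nat[OF p] .
  then have eq: "m * p + (p - 1) + 1 = (m + 1) * p" by simp
  have "[central_trinomial (m * p + (p - 1)) = central_trinomial m * central_trinomial (p - 1)] (mod int p)"
    using p0 by (intro central_trinomial_lucas[OF p]) auto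
  moreover have "[central_trinomial (m * p + (p - 1) + 1) = central_trinomial (m + 1)] (mod int p)"
    unfolding eq by (rule central_trinomial_mult_prime[OF p])
  ultimately have "[trinomial_form a b (m * p + (p - 1)) = a * (central_trinomial m * central_trinomial (p - 1))
      + b * central_trinomial (m + 1)] (mod int p)"
    unfolding trinomial_form_def by (intro cong_add cong_scalar_left)
  then show ?thesis
    by (simp add: trinomial_form_def algebra_simps)
qed

text \<open>Each appended digit p-1 multiplies a by T_(p-1), whose square is 1; two digits restore
  the form, hence the modulus p^2.\<close>

lemma trinomial_form_lucas_last_sq:
  assumes p: "prime p" and p3: "p > 3"
  shows "[trinomial_form a b (m * p ^ 2 + (p ^ 2 - 1)) = trinomial_form a b m] (mod int p)"
proof -
  let ?e = "central_trinomial (p - 1)"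
  obtain r where r: "p = Suc r" using p3 by (cases p) auto
  have eq: "m * p ^ 2 + (p ^ 2 - 1) = (m * p + (p - 1)) * p + (p - 1)"
    unfolding r by (simp add: power2_eq_square algebra_simps)
  have "[trinomial_form a b (m * p ^ 2 + (p ^ 2 - 1)) = trinomial_form (a * ?e) b (m * p + (p - 1))] (mod int p)"
    unfolding eq by (rule trinomial_form_lucas_last[OF p])
  also have "[trinomial_form (a * ?e) b (m * p + (p - 1)) = trinomial_form (a * ?e * ?e) b m] (mod int p)"
    by (rule trinomial_form_lucas_last[OF p])
  also have "trinomial_form (a * ?e * ?e) b m = (?e * ?e) * (a * central_trinomial m) + b * central_trinomial (m + 1)"
    by (simp add: trinomial_form_def algebra_simps)
  also have "[(?e * ?e) * (a * central_trinomial m) + b * central_trinomial (m + 1) =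
      1 * (a * central_trinomial m) + b * central_trinomial (m + 1)] (mod int p)"
    by (intro cong_add cong_scalar_right cong_refl central_trinomial_last_sq p p3)
  finally show ?thesis
    by (simp add: trinomial_form_def)
qed

text \<open>Put n = p-2-i. Multiplied by (-3)^(i+1), the form a T_n + b T_(n+1) becomes T_(p-1) (a
  T_(i+1) - 3 b T_i) by reflection, and both outer factors are units.\<close>

lemma form_zeros_reflect:
  assumes p: "prime p" and p3: "p > 3" and T: "\<forall>n<p. \<not> int p dvd central_trinomial n"
  shows "form_zeros p a b (p - 1) = form_zeros p (- 3 * b) a (p - 1)"
proof -
  let ?e = "central_trinomial (p - 1)"
  have e: "\<not> int p dvd ?e" using T p3 by simp
  have "int p dvd trinomial_form a b (p - 2 - i) \<longleftrightarrow> int p dvd trinomial_form (- 3 * b) a i"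
    if i: "i < p - 1" for i
  proof -
    have j: "p - 2 - i = p - 1 - (i + 1)" "p - 2 - i + 1 = p - 1 - i" using i by auto
    have "[(- 3) ^ (i + 1) * central_trinomial (p - 2 - i) = ?e * central_trinomial (i + 1)] (mod int p)"
      unfolding j(1) using i by (intro central_trinomial_reflect[OF p]) auto
    moreover have "[(- 3) ^ i * central_trinomial (p - 2 - i + 1) = ?e * central_trinomial i] (mod int p)"
      unfolding j(2) using i by (intro central_trinomial_reflect[OF p]) auto
    ultimately have "[a * ((- 3) ^ (i + 1) * central_trinomial (p - 2 - i))
        + (- 3 * b) * ((- 3) ^ i * central_trinomial (p - 2 - i + 1))
        = a * (?e * central_trinomial (i + 1)) + (- 3 * b) * (?e * central_trinomial i)] (mod int p)"
      by (intro cong_add cong_scalar_left)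
    then have "[(- 3) ^ (i + 1) * trinomial_form a b (p - 2 - i)
        = ?e * trinomial_form (- 3 * b) a i] (mod int p)"
      by (simp add: trinomial_form_def algebra_simps)
    then have "int p dvd (- 3) ^ (i + 1) * trinomial_form a b (p - 2 - i)
        \<longleftrightarrow> int p dvd ?e * trinomial_form (- 3 * b) a i"
      by (rule cong_dvd_iff)
    moreover have "\<not> int p dvd (- 3) ^ (i + 1)"
      using prime_gt_3_not_dvd_3[OF p3] p
      by (metis dvd_minus_iff prime_dvd_power prime_nat_int_transfer)
    ultimately show ?thesis
      using e prime_dvd_mult_int_iff[OF p] by blast
  qed
  moreover have "p - 2 - (p - 2 - i) = i" "p - 2 - i < p - 1" if "i < p - 1" for i
    using that by auto
  ultimately have "bij_betw (\<lambda>i. p - 2 - i) ({n. int p dvd trinomial_form (- 3 * b) a n} \<inter> {n. n < p - 1})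
      ({n. int p dvd trinomial_form a b n} \<inter> {n. n < p - 1})"
    by (intro bij_betwI[where g = "\<lambda>i. p - 2 - i"]) (simp_all add: Pi_def, metis)
  then show ?thesis
    unfolding form_zeros_def by (metis bij_betw_same_card)
qed

text \<open>Sort by last digit. A digit j < p-1 contributes p zeros or none, since T_m is a unit;
  the digit p-1 contributes the zeros of the twisted form.\<close>

lemma form_zeros_sq:
  assumes p: "prime p" and p3: "p > 3" and T: "\<forall>n<p. \<not> int p dvd central_trinomial n"
  shows "form_zeros p a b (p ^ 2 - 1) =
    p * form_zeros p a b (p - 1) + form_zeros p (a * central_trinomial (p - 1)) b (p - 1)"
proof -
  define S where "S = {n. int p dvd trinomial_form a b n}"
  define S' where "S' = {n. int p dvd trinomial_form (a * central_trinomial (p - 1)) b n}"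
  have count_Suc: "count_below A (Suc N) = count_below A N + of_bool (N \<in> A)" for A :: "nat set" and N
  proof -
    have "A \<inter> {n. n < Suc N} = (if N \<in> A then insert N (A \<inter> {n. n < N}) else A \<inter> {n. n < N})"
      by (auto simp: less_Suc_eq)
    then show ?thesis by simp
  qed
  have last: "residue_section p (p - 1) S = S'"
    using cong_dvd_iff[OF trinomial_form_lucas_last[OF p, of a b]]
    by (simp add: residue_section_def S_def S'_def)
  have inner: "residue_section p j S = (if j \<in> S then UNIV else {})" if "j < p - 1" for j
    using cong_dvd_iff[OF trinomial_form_lucas_power[OF p, of j 1 a b]] that
      central_trinomial_nonvanishing[OF p T] prime_dvd_mult_int_iff[OF p]
    by (auto simp: residue_section_def S_def)
  have p1: "Suc (p - 1) = p" "p ^ 2 = Suc (p ^ 2 - 1)" using p3 by auto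
  have split: "{..<p} = insert (p - 1) {..<p - 1}" using p3 by auto
  \<comment> \<open>The index excluded on the left corresponds to the index p-1 excluded on the
    right, so the two off-by-one terms cancel.\<close>
  have mem: "p ^ 2 - 1 \<in> S \<longleftrightarrow> p - 1 \<in> S'"
  proof -
    have "p ^ 2 - 1 = (p - 1) * p + (p - 1)"
      using p3 by (simp add: power2_eq_square algebra_simps)
    then show ?thesis unfolding last[symmetric] by (simp add: residue_section_def)
  qed
  have "count_below S (p ^ 2) = (\<Sum>j<p. count_below (residue_section p j S) p)"
    by (simp add: power2_eq_square count_below_mult)
  also have "\<dots> = count_below S' p + (\<Sum>j<p - 1. count_below (residue_section p j S) p)"
    unfolding split by (simp add: last[unfolded One_nat_def])
  also have "(\<Sum>j<p - 1. count_below (residue_section p j S) p) = (\<Sum>j<p - 1. if j \<in> S then p else 0)"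
    by (intro sum.cong) (auto simp: inner)
  also have "\<dots> = p * count_below S (p - 1)"
    by (simp add: sum.If_cases lessThan_def Int_commute)
  also have "count_below S' p = count_below S' (p - 1) + of_bool (p - 1 \<in> S')"
    using count_Suc[of S' "p - 1"] unfolding p1 .
  finally show ?thesis
    using count_Suc[of S "p ^ 2 - 1"] mem unfolding p1(2)[symmetric] form_zeros_def S_def S'_def by simp
qed

text \<open>The denominator counts the classes modulo p^2 other than the self-similar last
  one.\<close>

definition form_zero_density :: "nat \<Rightarrow> int \<Rightarrow> int \<Rightarrow> real" where
  "form_zero_density p a b = real (form_zeros p a b (p ^ 2 - 1)) / (real p ^ 2 - 1)"

lemma sum_of_bool_form_zeros:
  "(\<Sum>s<N. of_bool (int p dvd trinomial_form a b s)) = real (form_zeros p a b N)"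
  by (simp add: form_zeros_def sum.If_cases of_bool_def lessThan_def Int_commute)

lemma residue_section_form:
  assumes p: "prime p" and p3: "p > 3"
  shows "residue_section (p ^ 2) (p ^ 2 - 1) {n. [trinomial_form a b n = x] (mod int p)}
    = {n. [trinomial_form a b n = x] (mod int p)}"
  using trinomial_form_lucas_last_sq[OF p p3, of a b] unfolding residue_section_def cong_def by simp

lemma residue_section_form':
  assumes p: "prime p" and s: "s < p ^ 2 - 1"
  shows "residue_section (p ^ 2) s {n. [trinomial_form a b n = x] (mod int p)}
    = {m. [central_trinomial m * trinomial_form a b s = x] (mod int p)}"
  using trinomial_form_lucas_power[OF p, of s 2 a b] s unfolding residue_section_def cong_def by simp

text \<open>Since T_m never vanishes modulo p, each class modulo p^2 except the last consists of
  zeros entirely or not at all.\<close>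

lemma form_zero_density:
  assumes p: "prime p" and p3: "p > 3" and T: "\<forall>n<p. \<not> int p dvd central_trinomial n"
  shows "has_asymp_density {n. [trinomial_form a b n = 0] (mod int p)} (form_zero_density p a b)"
proof -
  let ?S = "{n. [trinomial_form a b n = 0] (mod int p)}"
  have "p ^ 2 > 1" using p3 by (intro one_less_power) auto
  moreover have "has_asymp_density (residue_section (p ^ 2) s ?S) (of_bool (int p dvd trinomial_form a b s))"
    if s: "s < p ^ 2 - 1" for s
  proof -
    have "residue_section (p ^ 2) s ?S = (if int p dvd trinomial_form a b s then UNIV else {})"
      unfolding residue_section_form'[OF p s] unfolding cong_0_iff
      using central_trinomial_nonvanishing[OF p T] prime_dvd_mult_int_iff[OF p] by auto
    then show ?thesis
      by (simp add: has_asymp_density_empty has_asymp_density_UNIV)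
  qed
  ultimately have "has_asymp_density ?S
      ((\<Sum>s<p ^ 2 - 1. of_bool (int p dvd trinomial_form a b s)) / (real (p ^ 2) - 1))"
    by (intro has_asymp_density_self_similar residue_section_form[OF p p3])
  then show ?thesis
    unfolding sum_of_bool_form_zeros form_zero_density_def by simp
qed

text \<open>On a class s where the form has unit value c, the value x occurs exactly when T_m = x/c,
  so equidistribution gives density 1/(p-1). Classes with c = 0 never produce x.\<close>

lemma form_value_density:
  assumes p: "prime p" and p3: "p > 3"
    and equi: "\<And>y. \<not> int p dvd y \<Longrightarrow>
      has_asymp_density {m. [central_trinomial m = y] (mod int p)} (1 / (real p - 1))"
    and x: "\<not> int p dvd x"
  shows "has_asymp_density {n. [trinomial_form a b n = x] (mod int p)}
    ((1 - form_zero_density p a b) / (real p - 1))"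
proof -
  let ?S = "{n. [trinomial_form a b n = x] (mod int p)}"
  define z :: "nat \<Rightarrow> real" where "z s = of_bool (int p dvd trinomial_form a b s)" for s
  have q: "p ^ 2 > 1" using p3 by (intro one_less_power) auto
  moreover have "has_asymp_density (residue_section (p ^ 2) s ?S) ((1 - z s) / (real p - 1))"
    if s: "s < p ^ 2 - 1" for s
  proof (cases "int p dvd trinomial_form a b s")
    case True
    then have "residue_section (p ^ 2) s ?S = {}"
      unfolding residue_section_form'[OF p s] using x cong_dvd_iff dvd_mult by blast
    then show ?thesis using True by (simp add: z_def has_asymp_density_empty)
  next
    case False
    let ?c = "trinomial_form a b s"
    have c: "coprime ?c (int p)" using False coprime_int_prime_iff[OF p] by blast
    then obtain c' where c': "[?c * c' = 1] (mod int p)"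
      using cong_solve_coprime_int by blast
    have "\<not> int p dvd c'"
    proof
      assume "int p dvd c'"
      then have "int p dvd 1"
        using cong_dvd_iff[OF c'] dvd_mult by blast
      then show False using p3 by simp
    qed
    then have y: "\<not> int p dvd x * c'"
      using x prime_dvd_mult_int_iff[OF p] by blast
    have "[central_trinomial m * ?c = x] (mod int p) \<longleftrightarrow> [central_trinomial m = x * c'] (mod int p)" for m
    proof -
      have "[x * c' * ?c = x] (mod int p)"
        using cong_scalar_left[OF c', of x] by (simp add: algebra_simps)
      then have "[central_trinomial m * ?c = x] (mod int p) \<longleftrightarrow>
          [central_trinomial m * ?c = x * c' * ?c] (mod int p)"
        by (meson cong_sym cong_trans)
      then show ?thesis using cong_mult_rcancel[OF c] by blast
    qed
    then show ?thesis
      unfolding residue_section_form'[OF p s] using equi[OF y] False by (simp add: z_def)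
  qed
  ultimately have "has_asymp_density ?S
      ((\<Sum>s<p ^ 2 - 1. (1 - z s) / (real p - 1)) / (real (p ^ 2) - 1))"
    by (intro has_asymp_density_self_similar residue_section_form[OF p p3])
  also have "(\<Sum>s<p ^ 2 - 1. (1 - z s) / (real p - 1)) =
      ((real p ^ 2 - 1) - real (form_zeros p a b (p ^ 2 - 1))) / (real p - 1)"
    using q unfolding sum_divide_distrib[symmetric] sum_subtractf z_def sum_of_bool_form_zeros
    by (simp add: of_nat_diff)
  also have "\<dots> / (real (p ^ 2) - 1) = (1 - form_zero_density p a b) / (real p - 1)"
  proof -
    have "real p ^ 2 - 1 = (real p - 1) * (real p + 1)"
      by (simp add: power2_eq_square algebra_simps)
    then have "real p ^ 2 - 1 \<noteq> 0" using p3 by simp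
    then show ?thesis by (simp add: form_zero_density_def field_simps)
  qed
  finally show ?thesis .
qed

lemma residue_section_motzkin:
  assumes p: "prime p" and k: "k < p"
  shows "residue_section p k {n. [2 * motzkin n = x] (mod int p)} =
    {m. [trinomial_form (motzkin_digit_alpha p k) (motzkin_digit_beta p k) m = x] (mod int p)}"
  using two_motzkin_lucas[OF p k] unfolding residue_section_def cong_def trinomial_form_def by simp

lemma form_zeros_scale:
  assumes p: "prime p" and "\<not> int p dvd c"
    and "\<And>n. [c * trinomial_form a b n = trinomial_form a' b' n] (mod int p)"
  shows "form_zeros p a' b' N = form_zeros p a b N"
proof -
  have "int p dvd trinomial_form a' b' n \<longleftrightarrow> int p dvd trinomial_form a b n" for n
    using cong_dvd_iff[OF assms(3)] assms(2) prime_dvd_mult_int_iff[OF p] by blast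
  then show ?thesis by (simp add: form_zeros_def)
qed

text \<open>With e = T_(p-1) and e^2 = 1, the form for digit p-2 is e (T_m - e T_(m+1)) and its
  twist is T_m - T_(m+1). Reflection reduces the form for digit p-1 and its twist to the same two
  counts, so both digits contribute (p |A| + |B|)/(p^2 - 1).\<close>

lemma sum_form_zero_density:
  assumes p: "prime p" and p3: "p > 3" and T: "\<forall>n<p. \<not> int p dvd central_trinomial n"
  shows "(\<Sum>k<p. form_zero_density p (motzkin_digit_alpha p k) (motzkin_digit_beta p k)) / real p
    = motzkin_zero_density p"
    and "{m. m < p - 1 \<and> [central_trinomial m = central_trinomial (p - 1) * central_trinomial (m + 1)] (mod int p)}
      \<noteq> {}"
proof -
  let ?e = "central_trinomial (p - 1)"
  have e: "\<not> int p dvd ?e" using T p3 by simp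
  have ee: "[?e * ?e = 1] (mod int p)" by (rule central_trinomial_last_sq[OF p p3])
  have n3: "\<not> int p dvd 3" by (rule prime_gt_3_not_dvd_3[OF p3])
  define A where "A = {m. m < p - 1 \<and> [central_trinomial m = ?e * central_trinomial (m + 1)] (mod int p)}"
  define B where "B = {m. m < p - 1 \<and> [central_trinomial m = central_trinomial (m + 1)] (mod int p)}"
  have A': "form_zeros p 1 (- ?e) (p - 1) = card A"
    unfolding form_zeros_def A_def
    by (rule arg_cong[where f = card]) (auto simp: trinomial_form_def cong_iff_dvd_diff)
  have B': "form_zeros p 1 (- 1) (p - 1) = card B"
    unfolding form_zeros_def B_def
    by (rule arg_cong[where f = card]) (auto simp: trinomial_form_def cong_iff_dvd_diff)
  have sc1: "[?e * trinomial_form 1 (- ?e) n = trinomial_form ?e (- 1) n] (mod int p)" for n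
  proof -
    have "[?e * central_trinomial n - (?e * ?e) * central_trinomial (n + 1)
        = ?e * central_trinomial n - 1 * central_trinomial (n + 1)] (mod int p)"
      by (intro cong_diff cong_refl cong_scalar_right ee)
    then show ?thesis by (simp add: trinomial_form_def algebra_simps)
  qed
  have sc2: "[1 * trinomial_form 1 (- 1) n = trinomial_form (?e * ?e) (- 1) n] (mod int p)" for n
  proof -
    have "[1 * central_trinomial n - central_trinomial (n + 1)
        = (?e * ?e) * central_trinomial n - central_trinomial (n + 1)] (mod int p)"
      by (intro cong_diff cong_refl cong_scalar_right cong_sym[OF ee])
    then show ?thesis by (simp add: trinomial_form_def)
  qed
  have sc3: "[(- 3) * trinomial_form 1 (- ?e) n = trinomial_form (- 3 * 1) (3 * ?e) n] (mod int p)" for n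
    by (simp add: trinomial_form_def algebra_simps)
  have sc4: "[(- 3) * trinomial_form 1 (- 1) n = trinomial_form (- 3 * 1) (3 * ?e * ?e) n] (mod int p)" for n
  proof -
    have "[- 3 * central_trinomial n + (3 * central_trinomial (n + 1)) * 1
        = - 3 * central_trinomial n + (3 * central_trinomial (n + 1)) * (?e * ?e)] (mod int p)"
      by (intro cong_add cong_refl cong_scalar_left cong_sym[OF ee])
    then show ?thesis by (simp add: trinomial_form_def algebra_simps)
  qed
  have p1: "\<not> int p dvd 1" using p3 by simp
  have m3: "\<not> int p dvd - 3" using n3 by simp
  have A3: "form_zeros p (3 * ?e) 1 (p - 1) = card A"
    unfolding form_zeros_reflect[OF p p3 T, of "3 * ?e" 1] A'[symmetric]
    by (rule form_zeros_scale[OF p m3 sc3])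
  have B3: "form_zeros p (3 * ?e * ?e) 1 (p - 1) = card B"
    unfolding form_zeros_reflect[OF p p3 T, of "3 * ?e * ?e" 1] B'[symmetric]
    by (rule form_zeros_scale[OF p m3 sc4])
  have pen: "form_zeros p ?e (- 1) (p ^ 2 - 1) = p * card A + card B"
    unfolding form_zeros_sq[OF p p3 T]
    using form_zeros_scale[OF p e sc1] form_zeros_scale[OF p p1 sc2] A' B' by simp
  have last: "form_zeros p (3 * ?e) 1 (p ^ 2 - 1) = p * card A + card B"
    unfolding form_zeros_sq[OF p p3 T] A3 B3 ..
  have q: "real p ^ 2 - 1 = (real p - 1) * (real p + 1)"
    by (simp add: power2_eq_square algebra_simps)
  have q0: "real p ^ 2 - 1 \<noteq> 0" using p3 unfolding q by simp
  \<comment> \<open>For lower digits the form is 2 M_k T_m, which vanishes always or never.\<close>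
  have low: "form_zero_density p (motzkin_digit_alpha p k) (motzkin_digit_beta p k)
      = of_bool ([motzkin k = 0] (mod int p))" if k: "k < p - 2" for k
  proof -
    have k': "k \<noteq> p - 2" "k \<noteq> p - 1" using k by auto
    have "trinomial_form (motzkin_digit_alpha p k) (motzkin_digit_beta p k) n
        = 2 * (motzkin k * central_trinomial n)" for n
      using k k' by (simp add: trinomial_form_def motzkin_digit_alpha_def motzkin_digit_beta_def)
    then have "int p dvd trinomial_form (motzkin_digit_alpha p k) (motzkin_digit_beta p k) n
        \<longleftrightarrow> [motzkin k = 0] (mod int p)" for n
      using prime_dvd_mult_int_iff[OF p] prime_gt_2_not_dvd_2[of p] p3
        central_trinomial_nonvanishing[OF p T] by (simp add: cong_0_iff)
    then have "form_zeros p (motzkin_digit_alpha p k) (motzkin_digit_beta p k) (p ^ 2 - 1)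
        = (if [motzkin k = 0] (mod int p) then p ^ 2 - 1 else 0)"
      by (simp add: form_zeros_def)
    then show ?thesis
      using q0 p3 by (simp add: form_zero_density_def of_nat_diff)
  qed
  have split: "{..<p} = insert (p - 1) (insert (p - 2) {..<p - 2})" using p3 by auto
  have ne: "p - 1 \<noteq> p - 2" using p3 by simp
  have combine: "(2 * ((P * x + y) / (u * v)) + c) / P = c / P + 2 * x / (u * v) + 2 * y / (u * P * v)"
    if "u \<noteq> 0" "v \<noteq> 0" "P \<noteq> 0" for u v P x y c :: real
    using that by (simp add: field_simps)
  have "(\<Sum>k<p. form_zero_density p (motzkin_digit_alpha p k) (motzkin_digit_beta p k))
      = 2 * ((real p * real (card A) + real (card B)) / (real p ^ 2 - 1))
        + (\<Sum>k<p - 2. form_zero_density p (motzkin_digit_alpha p k) (motzkin_digit_beta p k))"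
    unfolding split using pen last ne
    by (simp add: form_zero_density_def motzkin_digit_alpha_def motzkin_digit_beta_def)
  also have "(\<Sum>k<p - 2. form_zero_density p (motzkin_digit_alpha p k) (motzkin_digit_beta p k))
      = (\<Sum>k<p - 2. of_bool ([motzkin k = 0] (mod int p)))"
    by (intro sum.cong low) auto
  also have "\<dots> = real (card {k. k < p - 2 \<and> [motzkin k = 0] (mod int p)})"
    by (simp add: of_bool_def sum.If_cases lessThan_def Collect_conj_eq)
  finally show "(\<Sum>k<p. form_zero_density p (motzkin_digit_alpha p k) (motzkin_digit_beta p k)) / real p
    = motzkin_zero_density p"
    unfolding motzkin_zero_density_def A_def[symmetric] B_def[symmetric] q
    using combine[of "real p - 1" "real p + 1" "real p"] p3 by simp
  \<comment> \<open>If e = 1, then 0 lies in \<open>A\<close> because T_0 = T_1. If e = -1, then 3 e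
    T_1 + T_2 = 3 (e + 1) vanishes, and the reflected count \<open>A3\<close> turns this zero into
    an element of \<open>A\<close>.\<close>
  have "int p dvd (?e - 1) * (?e + 1)"
    using ee by (simp add: cong_iff_dvd_diff algebra_simps)
  then consider "int p dvd ?e - 1" | "int p dvd ?e + 1"
    using prime_dvd_mult_int_iff[OF p] by blast
  then have "A \<noteq> {}"
  proof cases
    case 1
    then have "0 \<in> A"
      using p3 by (simp add: A_def cong_iff_dvd_diff dvd_diff_commute)
    then show ?thesis by blast
  next
    case 2
    have "trinomial_form (3 * ?e) 1 1 = 3 * (?e + 1)"
      by (simp add: trinomial_form_def central_trinomial_2[unfolded numeral_2_eq_2])
    then have "1 \<in> {n. int p dvd trinomial_form (3 * ?e) 1 n} \<inter> {n. n < p - 1}"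
      using dvd_mult[OF 2, of 3] p3 by simp
    then have "form_zeros p (3 * ?e) 1 (p - 1) \<noteq> 0"
      unfolding form_zeros_def by (auto simp: card_eq_0_iff)
    then show ?thesis unfolding A3 by auto
  qed
  then show "{m. m < p - 1 \<and> [central_trinomial m = ?e * central_trinomial (m + 1)] (mod int p)} \<noteq> {}"
    by (simp add: A_def)
qed

section \<open>Equidistribution of T_n over the nonzero residues\<close>

text \<open>Concatenating base-p expansions multiplies values, so the attained residues are closed
  under products. They then contain inverses, which are powers, and hence the whole generated
  group.\<close>

lemma central_trinomial_residues_cover:
  assumes p: "prime p" and T: "\<forall>n<p. \<not> int p dvd central_trinomial n"
    and gen: "residues_generate_units p" and y: "\<not> int p dvd y"
  shows "\<exists>s. [central_trinomial s = y] (mod int p)"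
proof -
  define R where "R = residue_ring (int p)"
  interpret residues_prime p R
    using p by unfold_locales (simp_all add: R_def)
  let ?H = "(\<lambda>n. central_trinomial n mod int p) ` {n. n < p}"
  define P where "P x \<longleftrightarrow> (\<exists>s. [central_trinomial s = x] (mod int p))" for x
  have P_mult: "P (x * y)" if "P x" "P y" for x y
  proof -
    from that obtain s t where "[central_trinomial s = x] (mod int p)" "[central_trinomial t = y] (mod int p)"
      by (auto simp: P_def)
    then have "[central_trinomial s * central_trinomial t = x * y] (mod int p)"
      by (rule cong_mult)
    moreover have "t < p ^ t"
      using prime_gt_1_nat[OF p] by (simp add: power_gt_expt)
    then have "[central_trinomial (s * p ^ t + t) = central_trinomial s * central_trinomial t] (mod int p)"
      by (rule central_trinomial_lucas_power[OF p])
    ultimately show ?thesis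
      unfolding P_def using cong_trans by blast
  qed
  have P_1: "P 1" unfolding P_def by (rule exI[of _ 0]) simp
  have P_power: "P (x ^ n)" if "P x" for x n
    by (induction n) (auto intro: P_1 P_mult that)
  have P_mod: "P (x mod int p) \<longleftrightarrow> P x" for x
    by (simp add: P_def cong_def)
  have P_H: "P h" if "h \<in> ?H" for h
  proof -
    from that obtain n where "h = central_trinomial n mod int p" by blast
    moreover have "P (central_trinomial n)" unfolding P_def by (rule exI[of _ n]) simp
    ultimately show ?thesis by (simp add: P_mod)
  qed
  have H_units: "h \<in> Units R" if "h \<in> ?H" for h
  proof -
    from that obtain n where n: "n < p" "h = central_trinomial n mod int p" by auto
    then have "coprime (central_trinomial n) (int p)"
      using T coprime_int_prime_iff[OF p] by blast
    then show ?thesis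
      unfolding n using m_gt_one by simp
  qed
  have "P x" if "x \<in> generate (units_of R) ?H" for x
    using that
  proof (induction rule: generate.induct)
    case one
    then show ?case using P_1 by (simp add: units_of_one res_one_eq)
  next
    case (incl h)
    then show ?case by (rule P_H)
  next
    case (inv h)
    have h: "h \<in> Units R" using inv by (rule H_units)
    define i where "i = inv\<^bsub>R\<^esub> h"
    have "h \<otimes>\<^bsub>R\<^esub> i = 1"
      using Units_r_inv[OF h] by (simp add: i_def res_one_eq)
    then have hi: "[h * i = 1] (mod int p)"
      using m_gt_one by (simp add: res_mult_eq cong_def)
    have cop: "coprime h (int p)" using h by (simp add: res_units_eq)
    \<comment> \<open>Fermat identifies the inverse of h with h^(p-2), an attained residue.\<close>
    have "[h ^ (p - 1) = 1] (mod int p)"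
      using euler_theorem[OF cop] prime_totient_eq by simp
    moreover have "p - 1 = Suc (p - 2)" using prime_ge_2_nat[OF p] by simp
    ultimately have "[h * h ^ (p - 2) = 1] (mod int p)" by simp
    then have "[h * i = h * h ^ (p - 2)] (mod int p)"
      using hi cong_sym cong_trans by blast
    then have "[i = h ^ (p - 2)] (mod int p)"
      using cong_mult_lcancel[OF cop] by blast
    moreover have "P (h ^ (p - 2))" using P_H[OF inv] by (rule P_power)
    ultimately have "P i" unfolding P_def using cong_sym cong_trans by blast
    then show ?case using h by (simp add: i_def units_of_inv)
  next
    case (eng h1 h2)
    then have "P (h1 * h2)" by (intro P_mult)
    then show ?case by (simp add: units_of_mult res_mult_eq P_mod)
  qed
  moreover have "y mod int p \<in> generate (units_of R) ?H"
  proof -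
    have "coprime y (int p)" using y coprime_int_prime_iff[OF p] by blast
    then have "y mod int p \<in> carrier (units_of R)"
      using m_gt_one by (simp add: units_of_carrier)
    then show ?thesis using gen by (simp add: residues_generate_units_def R_def)
  qed
  ultimately have "P (y mod int p)" by blast
  then show ?thesis unfolding P_mod unfolding P_def .
qed

lemma mod_in_nonzero_residues:
  assumes "p > 0" "\<not> int p dvd y"
  shows "y mod int p \<in> {1..<int p}"
proof -
  have "0 \<le> y mod int p" "y mod int p < int p" "y mod int p \<noteq> 0"
    using assms by (auto simp: dvd_eq_mod_eq_0)
  then show ?thesis by simp
qed

lemma central_trinomial_residues_cover_bounded:
  assumes p: "prime p" and T: "\<forall>n<p. \<not> int p dvd central_trinomial n"
    and gen: "residues_generate_units p"
  shows "\<exists>l. \<forall>y. \<not> int p dvd y \<longrightarrow> (\<exists>s<p ^ l. [central_trinomial s = y] (mod int p))"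
proof -
  let ?U = "{1..<int p}"
  have "\<forall>y\<in>?U. \<exists>s. [central_trinomial s = y] (mod int p)"
  proof
    fix y assume "y \<in> ?U"
    then have "\<not> int p dvd y" by (auto dest: zdvd_imp_le)
    then show "\<exists>s. [central_trinomial s = y] (mod int p)"
      by (rule central_trinomial_residues_cover[OF p T gen])
  qed
  then obtain f where f: "\<And>y. y \<in> ?U \<Longrightarrow> [central_trinomial (f y) = y] (mod int p)"
    by metis
  \<comment> \<open>A crude common bound for all chosen indices; l < p^l then yields one block
    length for every unit.\<close>
  define l where "l = (\<Sum>y\<in>?U. f y)"
  have "\<exists>s<p ^ l. [central_trinomial s = y] (mod int p)" if y: "\<not> int p dvd y" for y
  proof -
    have U: "y mod int p \<in> ?U"
      using y prime_gt_0_nat[OF p] by (intro mod_in_nonzero_residues)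
    have "f (y mod int p) \<le> l"
      unfolding l_def using U by (intro member_le_sum) auto
    also have "l < p ^ l" using prime_gt_1_nat[OF p] by (simp add: power_gt_expt)
    finally show ?thesis using f[OF U] by (auto simp: cong_def)
  qed
  then show ?thesis by blast
qed

text \<open>Among the \<open>q = p\<^sup>l\<close> residue sections of \<open>{n. T\<^sub>n = x}\<close> there is one equal to
  \<open>{n. T\<^sub>n = y}\<close> for every unit \<open>y\<close>; the counting errors of these \<open>p - 1\<close> sections
  cancel, so the maximal error contracts with factor \<open>q - (p - 1) < q\<close>.\<close>
lemma central_trinomial_equidistributed:
  assumes p: "prime p" and T: "\<forall>n<p. \<not> int p dvd central_trinomial n"
    and gen: "residues_generate_units p" and x: "\<not> int p dvd x"
  shows "has_asymp_density {n. [central_trinomial n = x] (mod int p)} (1 / (real p - 1))"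
proof -
  have p1: "p > 1" using prime_gt_1_nat[OF p] .
  define U where "U = {1..<int p}"
  have finU: "finite U" and cardU: "card U = p - 1" and neU: "U \<noteq> {}"
    using p1 by (auto simp: U_def)
  have U_mod: "y mod int p \<in> U" if "\<not> int p dvd y" for y
    unfolding U_def using that p1 by (intro mod_in_nonzero_residues) auto
  have U_nd: "\<not> int p dvd y" if "y \<in> U" for y
    using that by (auto simp: U_def dest: zdvd_imp_le)
  have U_self: "y mod int p = y" if "y \<in> U" for y
    using that by (simp add: U_def)
  have nd: "\<not> int p dvd central_trinomial n" for n
    by (rule central_trinomial_nonvanishing[OF p T])
  obtain l where l: "\<And>y. \<not> int p dvd y \<Longrightarrow> \<exists>s<p ^ l. [central_trinomial s = y] (mod int p)"
    using central_trinomial_residues_cover_bounded[OF p T gen] by blast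
  define q where "q = p ^ l"
  have q0: "q > 0" using p1 by (simp add: q_def)
  define S where "S y = {n. [central_trinomial n = y] (mod int p)}" for y
  define E where "E y N = real (count_below (S y) N) - 1 / (real p - 1) * real N" for y N
  define V where "V N = Max ((\<lambda>y. \<bar>E y N\<bar>) ` U)" for N
  have V: "\<bar>E y N\<bar> \<le> V N" if "y \<in> U" for y N
    unfolding V_def using that finU by (intro Max_ge) auto

  \<comment> \<open>Because T_n is always a unit, the sets \<open>S y\<close> partition the
    naturals, so their counting errors sum to zero.\<close>
  have sum_E: "(\<Sum>y\<in>U. E y N) = 0" for N
  proof -
    have "(\<Sum>y\<in>U. count_below (S y) N) = card (\<Union>y\<in>U. S y \<inter> {n. n < N})"
      by (intro card_UN_disjoint[symmetric] finU)
        (auto simp: S_def cong_def U_self)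
    also have "(\<Union>y\<in>U. S y \<inter> {n. n < N}) = {n. n < N}"
      using U_mod[OF nd] by (auto simp: S_def cong_def intro!: bexI[of _ "central_trinomial _ mod int p"])
    finally have "(\<Sum>y\<in>U. count_below (S y) N) = N" by simp
    then have "(\<Sum>y\<in>U. real (count_below (S y) N)) = real N"
      by (metis of_nat_sum)
    then show ?thesis
      using p1 by (simp add: E_def sum_subtractf cardU of_nat_diff)
  qed

  define C where "C = real q + \<bar>\<Sum>j<q. 1 / (real p - 1)\<bar>"
  have q_gt: "p - 1 \<le> q" and step: "V N \<le> (real q - (real p - 1)) * V (N div q) + C" for N
  proof -
    have *: "p - 1 \<le> q \<and> \<bar>E x N\<bar> \<le> (real q - (real p - 1)) * V (N div q) + C" if x: "x \<in> U" for x
    proof -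
      \<comment> \<open>The witness z is x/T_s, so that appending the block s to m turns the
        condition T_m = z into the value x.\<close>
      have "\<exists>z\<in>U. [z * central_trinomial s = x] (mod int p)" for s
      proof -
        have "coprime (central_trinomial s) (int p)"
          using nd coprime_int_prime_iff[OF p] by blast
        then obtain t where t: "[central_trinomial s * t = 1] (mod int p)"
          using cong_solve_coprime_int by blast
        have tx: "[(x * t) * central_trinomial s = x] (mod int p)"
          using cong_scalar_left[OF t, of x] by (simp add: algebra_simps)
        then have "\<not> int p dvd x * t"
          using cong_dvd_iff[OF tx] U_nd[OF x] dvd_mult2 by blast
        moreover have "[(x * t) mod int p * central_trinomial s = x] (mod int p)"
          using tx by (simp add: cong_def mod_mult_left_eq)
        ultimately show ?thesis using U_mod by blast
      qed
      then obtain z where z: "\<And>s. z s \<in> U" "\<And>s. [z s * central_trinomial s = x] (mod int p)"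
        by metis
      have sec: "residue_section q s (S x) = S (z s)" if s: "s < q" for s
      proof -
        have cop: "coprime (central_trinomial s) (int p)"
          using nd coprime_int_prime_iff[OF p] by blast
        have "[central_trinomial (m * q + s) = x] (mod int p) \<longleftrightarrow> [central_trinomial m = z s] (mod int p)" for m
        proof -
          have "[central_trinomial (m * q + s) = x] (mod int p) \<longleftrightarrow>
              [central_trinomial m * central_trinomial s = z s * central_trinomial s] (mod int p)"
            using central_trinomial_lucas_power[OF p, of s l m] s z(2)[of s]
            unfolding q_def by (meson cong_sym cong_trans)
          then show ?thesis using cong_mult_rcancel[OF cop] by blast
        qed
        then show ?thesis by (simp add: residue_section_def S_def)
      qed
      \<comment> \<open>Every unit y occurs as x/T_s: some s below q has T_s = x/y.\<close>
      have "\<exists>s<q. z s = y" if y: "y \<in> U" for y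
      proof -
        have cop: "coprime y (int p)" using U_nd[OF y] coprime_int_prime_iff[OF p] by blast
        then obtain t where t: "[y * t = 1] (mod int p)"
          using cong_solve_coprime_int by blast
        have ytx: "[y * (t * x) = x] (mod int p)"
          using cong_scalar_right[OF t, of x] by (simp add: algebra_simps)
        then have "\<not> int p dvd t * x"
          using cong_dvd_iff[OF ytx] U_nd[OF x] dvd_mult by blast
        then obtain s where s: "s < q" "[central_trinomial s = t * x] (mod int p)"
          using l unfolding q_def by blast
        have "[y * central_trinomial s = x] (mod int p)"
          using cong_scalar_left[OF s(2), of y] ytx cong_trans by blast
        then have "[z s * central_trinomial s = y * central_trinomial s] (mod int p)"
          using z(2)[of s] cong_sym cong_trans by blast
        moreover have "coprime (central_trinomial s) (int p)"
          using nd coprime_int_prime_iff[OF p] by blast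
        ultimately have "[z s = y] (mod int p)"
          using cong_mult_rcancel by blast
        then have "z s = y" using U_self[OF y] U_self[OF z(1)] by (simp add: cong_def)
        with s show ?thesis by blast
      qed
      \<comment> \<open>One block per unit is selected. The errors over these p-1 blocks cancel by
        \<open>sum_E\<close>, leaving q-(p-1) blocks to estimate.\<close>
      then obtain f where f: "\<And>y. y \<in> U \<Longrightarrow> f y < q \<and> z (f y) = y" by metis
      have inj: "inj_on f U" by (rule inj_on_inverseI[where g = z]) (use f in auto)
      have sub: "f ` U \<subseteq> {..<q}" using f by auto
      have card_f: "card (f ` U) = p - 1" using inj cardU by (simp add: card_image)
      have le: "p - 1 \<le> q" using card_mono[OF _ sub] card_f by simp
      have "(\<Sum>s\<in>f ` U. E (z s) (N div q)) = (\<Sum>y\<in>U. E y (N div q))"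
        using f by (simp add: sum.reindex[OF inj])
      then have zero: "(\<Sum>s\<in>f ` U. E (z s) (N div q)) = 0" by (simp add: sum_E)
      have "(\<Sum>s<q. E (z s) (N div q)) = (\<Sum>s\<in>{..<q} - f ` U. E (z s) (N div q))"
        using sum.subset_diff[OF sub, of "\<lambda>s. E (z s) (N div q)"] zero by simp
      also have "\<bar>\<dots>\<bar> \<le> (\<Sum>s\<in>{..<q} - f ` U. V (N div q))"
        using V z(1) by (intro order_trans[OF sum_abs] sum_mono) auto
      also have "\<dots> = (real q - (real p - 1)) * V (N div q)"
        using sub le p1 card_f by (simp add: card_Diff_subset finite_subset[OF sub] of_nat_diff)
      finally have main: "\<bar>\<Sum>s<q. E (z s) (N div q)\<bar> \<le> (real q - (real p - 1)) * V (N div q)" .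
      have "(\<Sum>s<q. real (count_below (residue_section q s (S x)) (N div q))
          - 1 / (real p - 1) * real (N div q)) = (\<Sum>s<q. E (z s) (N div q))"
        by (intro sum.cong) (auto simp: sec E_def)
      then have "\<bar>E x N - (\<Sum>s<q. E (z s) (N div q))\<bar> \<le> C"
        using count_below_error[OF q0, of "S x" N "\<lambda>_. 1 / (real p - 1)"] q0
        unfolding C_def E_def[of x N] by simp
      then show ?thesis using le main by linarith
    qed
    show "p - 1 \<le> q" using * neU by blast
    show "V N \<le> (real q - (real p - 1)) * V (N div q) + C"
      unfolding V_def[of N] using * finU neU by (intro Max.boundedI) auto
  qed

  have "sublinear V"
  proof (rule sublinear_contraction[where r = "real q - (real p - 1)" and q = q and h = "\<lambda>_. C"
        and B = "1 + 1 / (real p - 1)"])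
    show "0 \<le> real q - (real p - 1)" "real q - (real p - 1) < real q"
      using q_gt p1 by auto
    show "sublinear (\<lambda>N. C)" by (rule sublinear_const)
    show "V N \<le> (real q - (real p - 1)) * V (N div q) + C" for N by (rule step)
    fix N
    have "\<bar>E y N\<bar> \<le> (1 + 1 / (real p - 1)) * real N" for y
    proof -
      have "\<bar>E y N\<bar> \<le> \<bar>real (count_below (S y) N)\<bar> + \<bar>1 / (real p - 1) * real N\<bar>"
        unfolding E_def by (rule abs_triangle_ineq4)
      also have "\<dots> \<le> real N + 1 / (real p - 1) * real N"
        using count_below_le[of "S y" N] p1 by (intro add_mono) auto
      finally show ?thesis by (simp add: algebra_simps)
    qed
    then show "V N \<le> (1 + 1 / (real p - 1)) * real N"
      unfolding V_def using finU neU by (intro Max.boundedI) auto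
  qed
  then have "sublinear (\<lambda>N. \<bar>E (x mod int p) N\<bar>)"
    using V[OF U_mod[OF x]] by (rule sublinear_mono)
  moreover have "S (x mod int p) = {n. [central_trinomial n = x] (mod int p)}"
    by (simp add: S_def cong_def)
  ultimately show ?thesis
    unfolding has_asymp_density_iff_sublinear E_def by simp
qed

section \<open>Assembling the densities of Motzkin residues\<close>

lemma value_density_motzkin_iff:
  assumes p: "prime p" and p2: "p > 2" and x: "0 \<le> x" "x < int p"
  shows "value_density_mod p motzkin x d \<longleftrightarrow>
    has_asymp_density {n. [2 * motzkin n = 2 * x] (mod int p)} d"
proof -
  have "coprime 2 (int p)"
    using prime_gt_2_not_dvd_2[OF p2] coprime_int_prime_iff[OF p] by blast
  then have "[2 * motzkin n = 2 * x] (mod int p) \<longleftrightarrow> motzkin n mod int p = x" for n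
    using x cong_mult_lcancel[of 2 "int p" "motzkin n" x] by (simp add: cong_def)
  then show ?thesis by (simp add: value_density_mod_def)
qed

text \<open>The prime 3 divides T_2 = 3, so it belongs to the vanishing case.\<close>

lemma nonvanishing_prime_gt_3:
  assumes "prime p" "p > 2" "\<forall>n<p. \<not> int p dvd central_trinomial n"
  shows "p > 3"
proof (rule ccontr)
  assume "\<not> p > 3"
  with assms(2) have "p = 3" by simp
  then show False using assms(3)[rule_format, of 2] central_trinomial_2 by simp
qed

lemma motzkin_zero_density_eq:
  assumes p: "prime p" and p2: "p > 2" and T: "\<forall>n<p. \<not> int p dvd central_trinomial n"
  shows "value_density_mod p motzkin 0 (motzkin_zero_density p)"
proof -
  have p3: "p > 3" using nonvanishing_prime_gt_3[OF assms] .
  have "has_asymp_density {n. [2 * motzkin n = 0] (mod int p)} (motzkin_zero_density p)"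
    unfolding sum_form_zero_density(1)[OF p p3 T, symmetric]
  proof (rule has_asymp_density_sections)
    show "p > 0" using p3 by simp
    show "has_asymp_density (residue_section p k {n. [2 * motzkin n = 0] (mod int p)})
        (form_zero_density p (motzkin_digit_alpha p k) (motzkin_digit_beta p k))" if "k < p" for k
      unfolding residue_section_motzkin[OF p that] by (rule form_zero_density[OF p p3 T])
  qed
  then show ?thesis
    using value_density_motzkin_iff[OF p p2, of 0] p2 by simp
qed

lemma motzkin_nonzero_density_eq:
  assumes p: "prime p" and p2: "p > 2" and T: "\<forall>n<p. \<not> int p dvd central_trinomial n"
    and gen: "residues_generate_units p" and x: "x \<in> {1..<int p}"
  shows "value_density_mod p motzkin x ((1 - motzkin_zero_density p) / (real p - 1))"
proof -
  have p3: "p > 3" using nonvanishing_prime_gt_3[OF p p2 T] .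
  define z where "z k = form_zero_density p (motzkin_digit_alpha p k) (motzkin_digit_beta p k)" for k
  have "\<not> int p dvd x" using x by (auto dest: zdvd_imp_le)
  then have x2: "\<not> int p dvd 2 * x"
    using prime_dvd_mult_int_iff[OF p] prime_gt_2_not_dvd_2[OF p2] by blast
  have "has_asymp_density {n. [2 * motzkin n = 2 * x] (mod int p)}
      ((\<Sum>k<p. (1 - z k) / (real p - 1)) / real p)"
  proof (rule has_asymp_density_sections)
    show "p > 0" using p3 by simp
    show "has_asymp_density (residue_section p k {n. [2 * motzkin n = 2 * x] (mod int p)})
        ((1 - z k) / (real p - 1))" if "k < p" for k
      unfolding residue_section_motzkin[OF p that] z_def
      by (intro form_value_density p p3 x2 central_trinomial_equidistributed T gen)
  qed
  also have "(\<Sum>k<p. (1 - z k) / (real p - 1)) = (real p - (\<Sum>k<p. z k)) / (real p - 1)"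
    by (simp add: sum_divide_distrib[symmetric] sum_subtractf)
  also have "\<dots> / real p = (1 - (\<Sum>k<p. z k) / real p) / (real p - 1)"
    using p3 by (simp add: field_simps)
  also have "(\<Sum>k<p. z k) / real p = motzkin_zero_density p"
    unfolding z_def by (rule sum_form_zero_density(1)[OF p p3 T])
  finally show ?thesis
    using value_density_motzkin_iff[OF p p2, of x] x by simp
qed

text \<open>The sets \<open>A\<close> and \<open>B\<close> each have an element, with 0 in
  \<open>B\<close> because T_0 = T_1. The last two summands alone are then at least 2/((p-1)(p+1)) +
  2/((p-1)p(p+1)), which equals the bound.\<close>

lemma motzkin_zero_density_ge:
  assumes p: "prime p" and p2: "p > 2" and T: "\<forall>n<p. \<not> int p dvd central_trinomial n"
  shows "motzkin_zero_density p \<ge> 2 / (real p * (real p - 1))"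
proof -
  have p3: "p > 3" using nonvanishing_prime_gt_3[OF assms] .
  define A where "A = {m. m < p - 1 \<and> [central_trinomial m = central_trinomial (p - 1) * central_trinomial (m + 1)] (mod int p)}"
  define B where "B = {m. m < p - 1 \<and> [central_trinomial m = central_trinomial (m + 1)] (mod int p)}"
  have "finite A" "finite B" by (simp_all add: A_def B_def)
  moreover have "A \<noteq> {}" unfolding A_def by (rule sum_form_zero_density(2)[OF p p3 T])
  moreover have "0 \<in> B" using p3 by (simp add: B_def)
  ultimately have "card A \<ge> 1" "card B \<ge> 1"
    by (auto simp: Suc_le_eq card_gt_0_iff)
  then have AB: "2 * 1 \<le> 2 * real (card A)" "2 * 1 \<le> 2 * real (card B)" by auto
  define P where "P = real p"
  have P: "P > 1" using p3 by (simp add: P_def)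
  define u v where "u = P - 1" and "v = P + 1"
  have uv: "u > 0" "v > 0" "v = P + 1" using P by (auto simp: u_def v_def)
  have "2 / (P * u) = 2 * v / (u * P * v)"
    using uv(2) by (simp add: mult.commute)
  also have "\<dots> = 2 * (P + 1) / (u * P * v)"
    by (simp add: uv(3))
  also have "\<dots> = 2 * 1 / (u * v) + 2 * 1 / (u * P * v)"
    using uv(1,2) P by (simp add: field_simps)
  also have "\<dots> \<le> 2 * real (card A) / (u * v) + 2 * real (card B) / (u * P * v)"
    using AB uv P by (intro add_mono divide_right_mono) auto
  also have "\<dots> \<le> motzkin_zero_density p"
    unfolding motzkin_zero_density_def A_def[symmetric] B_def[symmetric] P_def[symmetric]
      u_def[symmetric] v_def[symmetric] using P by simp
  finally show ?thesis by (simp add: P_def u_def)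
qed

theorem corollary13:
  fixes p :: nat
  assumes "prime p"
  shows
    "((\<exists>n<p. int p dvd central_trinomial n) \<longrightarrow> value_density_mod p motzkin 0 1)
   \<and> (p > 2 \<and> (\<forall>n<p. \<not> int p dvd central_trinomial n) \<longrightarrow>
        value_density_mod p motzkin 0 (motzkin_zero_density p))
   \<and> (p > 2 \<and> (\<forall>n<p. \<not> int p dvd central_trinomial n) \<longrightarrow>
        (\<forall>r::nat. prime r \<and> (\<forall>n<r. \<not> int r dvd central_trinomial n) \<longrightarrow>
           residues_generate_units r) \<longrightarrow>
        (\<forall>x\<in>{1..<int p}.
           value_density_mod p motzkin x ((1 - motzkin_zero_density p) / (real p - 1))))
   \<and> (p > 2 \<longrightarrow>
        (\<exists>D\<^sub>0. value_density_mod p motzkin 0 D\<^sub>0 \<and> D\<^sub>0 \<ge> 2 / (real p * (real p - 1))))"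
proof (intro conjI impI ballI)
  assume "\<exists>n<p. int p dvd central_trinomial n"
  then show "value_density_mod p motzkin 0 1"
    using motzkin_zero_density_1[OF assms] by blast
next
  assume "p > 2 \<and> (\<forall>n<p. \<not> int p dvd central_trinomial n)"
  then show "value_density_mod p motzkin 0 (motzkin_zero_density p)"
    using motzkin_zero_density_eq[OF assms] by blast
next
  fix x
  assume "p > 2 \<and> (\<forall>n<p. \<not> int p dvd central_trinomial n)"
    and "\<forall>r. prime r \<and> (\<forall>n<r. \<not> int r dvd central_trinomial n) \<longrightarrow> residues_generate_units r"
    and "x \<in> {1..<int p}"
  then show "value_density_mod p motzkin x ((1 - motzkin_zero_density p) / (real p - 1))"
    using motzkin_nonzero_density_eq[OF assms] assms by blast
next
  assume p2: "p > 2"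
  show "\<exists>D\<^sub>0. value_density_mod p motzkin 0 D\<^sub>0 \<and> D\<^sub>0 \<ge> 2 / (real p * (real p - 1))"
  proof (cases "\<exists>n<p. int p dvd central_trinomial n")
    case True
    \<comment> \<open>Here the density is 1, and p >= 3 makes the required bound at most
      1/3.\<close>
    have "3 * 2 \<le> real p * (real p - 1)"
      using p2 by (intro mult_mono) auto
    then have "2 / (real p * (real p - 1)) \<le> 1"
      by (simp add: divide_le_eq)
    then show ?thesis
      using True motzkin_zero_density_1[OF assms] by blast
  next
    case False
    then show ?thesis
      using motzkin_zero_density_eq[OF assms p2] motzkin_zero_density_ge[OF assms p2] by blast
  qed
qed

end
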